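(* Let $F(\omega)$ be the attractor of a $V$-variable random iterated function system of contracting similarities on $\mathbb R^d$ ($V\in\mathbb N$). Irrespective of overlaps, almost surely, $$\dim_H F(\omega)=\overline{\dim}_B F(\omega)=\dim_B F(\omega),$$ where $\dim_H$, $\overline{\dim}_B$, $\dim_B$ denote the Hausdorff, upper box-counting and box-counting dimension.
   Context: $V$-variable random iterated function system (in the sense of Barnsley, Hutchinson and Stenflo). Let $\{\mathbb I_i\}_{i\in\mathcal L}$ be a finite family of iterated function systems $\mathbb I_i=\{f^i_1,\dots,f^i_{M_i}\}$, $M_i\ge1$, where each $f^i_m:\mathbb R^d\to\mathbb R^d$ is a contracting similarity, and let $(\pi_i)_{i\in\mathcal L}$ be a probability vector with all $\pi_i>0$. For every level $k\in\mathbb N$ and every $v\in\{1,\dots,V\}$ choose at random an index $I_k(v)\in\mathcal L$ with distribution $(\pi_i)$ and, for each $m\in\{1,\dots,M_{I_k(v)}\}$, a type $J_k(v,m)\in\{1,\dots,V\}$ uniformly distributed; all choices are independent. The realisation $\omega$ is the collection of all these choices. Let $\Delta\subset\mathbb R^d$ be a non-empty compact set with $f^i_m(\Delta)\subset\Delta$ for all $i,m$. The attractor of type $v$ is $$F_v(\omega)=\bigcap_{k\ge1}\ \bigcup_{(m_1,\dots,m_k)}f^{I_1(v_1)}_{m_1}\circ f^{I_2(v_2)}_{m_2}\circ\dots\circ f^{I_k(v_k)}_{m_k}(\Delta),$$ where $v_1=v$, $v_{l+1}=J_l(v_l,m_l)$ and $1\le m_l\le M_{I_l(v_l)}$. The $V$-variable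 attractor is $F(\omega)=F_1(\omega)$. *)

theory Defs
  imports "HOL-Probability.Probability"
begin

definition contracting_similarity :: "('a::metric_space \<Rightarrow> 'a) \<Rightarrow> bool" where
  "contracting_similarity g \<longleftrightarrow>
     (\<exists>r. 0 < r \<and> r < 1 \<and> (\<forall>x y. dist (g x) (g y) = r * dist x y))"


subsection \<open>Hausdorff dimension\<close>

text \<open>The summand \<open>|U|^s\<close> of the Hausdorff measure. In HOL \<open>0 powr 0 = 0\<close>, so the convention that
  \<open>|U|^0 = 1\<close> for non-empty \<open>U\<close> has to be built in.\<close>

definition diam_powr :: "real \<Rightarrow> 'a::metric_space set \<Rightarrow> real" where
  "diam_powr s U = (if U = {} then 0 else if s = 0 then 1 else diameter U powr s)"

text \<open>The boundedness condition is needed because \<^const>\<open>diameter\<close> is only meaningful on bounded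
  sets. Finite covers are included, since the \<open>U i\<close> may be empty.\<close>

definition delta_covers :: "real \<Rightarrow> 'a::metric_space set \<Rightarrow> (nat \<Rightarrow> 'a set) set" where
  "delta_covers \<delta> F = {U. F \<subseteq> (\<Union>i. U i) \<and> (\<forall>i. bounded (U i) \<and> diameter (U i) \<le> \<delta>)}"

definition hausdorff_premeasure :: "real \<Rightarrow> real \<Rightarrow> 'a::metric_space set \<Rightarrow> ennreal" where
  "hausdorff_premeasure s \<delta> F = (INF U\<in>delta_covers \<delta> F. \<Sum>i. ennreal (diam_powr s (U i)))"

definition hausdorff_measure :: "real \<Rightarrow> 'a::metric_space set \<Rightarrow> ennreal" where
  "hausdorff_measure s F = (SUP \<delta>\<in>{0<..}. hausdorff_premeasure s \<delta> F)"

definition hausdorff_dim :: "'a::metric_space set \<Rightarrow> ereal" where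
  "hausdorff_dim F = (INF s\<in>{s. 0 \<le> s \<and> hausdorff_measure s F = 0}. ereal s)"


subsection \<open>Box-counting dimension\<close>

text \<open>Only used for non-empty totally bounded \<open>F\<close>, for which finite covers of the required kind
  exist.\<close>

definition covering_number :: "real \<Rightarrow> 'a::metric_space set \<Rightarrow> nat" where
  "covering_number \<delta> F =
     (LEAST n. \<exists>C. finite C \<and> card C = n \<and> F \<subseteq> \<Union>C \<and> (\<forall>U\<in>C. bounded U \<and> diameter U \<le> \<delta>))"

definition box_ratio :: "'a::metric_space set \<Rightarrow> real \<Rightarrow> ereal" where
  "box_ratio F \<delta> = ereal (ln (real (covering_number \<delta> F)) / - ln \<delta>)"

definition upper_box_dim :: "'a::metric_space set \<Rightarrow> ereal" where
  "upper_box_dim F = Limsup (at_right 0) (box_ratio F)"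

text \<open>The box-counting dimension exists and equals \<open>s\<close>.\<close>

definition has_box_dim :: "'a::metric_space set \<Rightarrow> ereal \<Rightarrow> bool" where
  "has_box_dim F s \<longleftrightarrow> (box_ratio F \<longlongrightarrow> s) (at_right 0)"


subsection \<open>V-variable random iterated function systems\<close>

text \<open>The choice made at one level for one type is a pair \<open>(i, J)\<close>: first the index \<open>i\<close> with
  distribution \<open>p\<close>, then independent uniform types \<open>J m\<close> for \<open>1 \<le> m \<le> M i\<close>. For other \<open>m\<close>, the
  value \<open>J m\<close> is the dummy \<open>undefined\<close>.\<close>

definition choice_pmf :: "'l pmf \<Rightarrow> ('l \<Rightarrow> nat) \<Rightarrow> nat \<Rightarrow> ('l \<times> (nat \<Rightarrow> nat)) pmf" where
  "choice_pmf p M V =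
     bind_pmf p (\<lambda>i. map_pmf (\<lambda>J. (i, J)) (Pi_pmf {1..M i} undefined (\<lambda>_. pmf_of_set {1..V})))"

type_synonym 'l realisation = "nat \<times> nat \<Rightarrow> 'l \<times> (nat \<Rightarrow> nat)"

text \<open>Realisations \<open>\<omega>\<close> are indexed by pairs \<open>(k, v)\<close> of a level \<open>k \<ge> 1\<close> and a type \<open>v\<close>.\<close>

definition realisation_measure :: "'l pmf \<Rightarrow> ('l \<Rightarrow> nat) \<Rightarrow> nat \<Rightarrow> 'l realisation measure" where
  "realisation_measure p M V = Pi\<^sub>M ({1..} \<times> {1..V}) (\<lambda>_. measure_pmf (choice_pmf p M V))"

definition IFS_index :: "'l realisation \<Rightarrow> nat \<Rightarrow> nat \<Rightarrow> 'l" where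
  "IFS_index \<omega> k v = fst (\<omega> (k, v))"

definition next_type :: "'l realisation \<Rightarrow> nat \<Rightarrow> nat \<Rightarrow> nat \<Rightarrow> nat" where
  "next_type \<omega> k v m = snd (\<omega> (k, v)) m"

text \<open>In the following two functions, the word is read off starting at level \<open>l\<close> in type \<open>v\<close>.\<close>

fun admissible :: "('l \<Rightarrow> nat) \<Rightarrow> 'l realisation \<Rightarrow> nat \<Rightarrow> nat \<Rightarrow> nat list \<Rightarrow> bool" where
  "admissible M \<omega> l v [] \<longleftrightarrow> True"
| "admissible M \<omega> l v (m # ms) \<longleftrightarrow>
     1 \<le> m \<and> m \<le> M (IFS_index \<omega> l v) \<and> admissible M \<omega> (Suc l) (next_type \<omega> l v m) ms"

fun word_map ::
  "('l \<Rightarrow> nat \<Rightarrow> 'a \<Rightarrow> 'a) \<Rightarrow> 'l realisation \<Rightarrow> nat \<Rightarrow> nat \<Rightarrow> nat list \<Rightarrow> 'a \<Rightarrow> 'a" where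
  "word_map f \<omega> l v [] = id"
| "word_map f \<omega> l v (m # ms) =
     f (IFS_index \<omega> l v) m \<circ> word_map f \<omega> (Suc l) (next_type \<omega> l v m) ms"

definition typed_attractor ::
  "('l \<Rightarrow> nat) \<Rightarrow> ('l \<Rightarrow> nat \<Rightarrow> 'a \<Rightarrow> 'a) \<Rightarrow> 'a set \<Rightarrow> 'l realisation \<Rightarrow> nat \<Rightarrow> 'a set" where
  "typed_attractor M f \<Delta> \<omega> v =
     (\<Inter>k\<in>{1..}. \<Union>ms\<in>{ms. length ms = k \<and> admissible M \<omega> 1 v ms}. word_map f \<omega> 1 v ms ` \<Delta>)"

definition V_variable_attractor ::
  "('l \<Rightarrow> nat) \<Rightarrow> ('l \<Rightarrow> nat \<Rightarrow> 'a \<Rightarrow> 'a) \<Rightarrow> 'a set \<Rightarrow> 'l realisation \<Rightarrow> 'a set" where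
  "V_variable_attractor M f \<Delta> \<omega> = typed_attractor M f \<Delta> \<omega> 1"

end

theory Submission
  imports Defs "HOL-Real_Asymp.Real_Asymp"
begin

text \<open>The Hausdorff dimension of a bounded set never exceeds its lower box-counting dimension, so it is
  enough to bound the upper box-counting dimension of the attractor by its Hausdorff dimension.

  Fix an open ball whose closure contains \<open>\<Delta>\<close> and which is mapped into itself by all maps; its image
  under a word is the cell of the word. A block of length \<open>k\<close> is a set of words of length \<open>k\<close>, read from a common level
  and type and ending in a common type, with pairwise disjoint cells. For \<open>s > 0\<close> let \<open>W k\<close> be the
  greatest sum of the \<open>s\<close>-th powers of the similarity ratios over a block of length \<open>k\<close> from type 1
  at level 1. Concatenations of blocks are blocks (\<open>block_concat\<close>), so the logarithms of the weights
  are superadditive; no condition on overlaps enters. Two deterministic facts link the weights to the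
  dimensions.

  \<^item> If \<open>W k \<le> C * exp (\<epsilon> * k)\<close> for all \<open>k\<close>, then the upper box dimension is at most
    \<open>s + \<epsilon> / - ln b\<close>, where \<open>b\<close> is the largest ratio (\<open>upper_box_dim_le\<close>): at scale \<open>\<delta>\<close> stop each
    word when its ratio drops to about \<open>\<delta>\<close>. For each of the \<open>O(ln (1/\<delta>))\<close> lengths and each end type,
    the cells of a maximal block of stopped words, enlarged by a constant factor, cover those of all
    the others, and such a block has at most about \<open>W k * \<delta> powr - s\<close> words.
  \<^item> If blocks of a fixed length can be chained such that the products of their weights stay bounded
    away from 0, then the Hausdorff dimension is at least \<open>s\<close> (\<open>hausdorff_dim_ge\<close>), by the mass
    distribution principle on the Cantor set that they generate.

  For fixed \<open>s\<close> and \<open>\<epsilon>\<close>, one of the two cases occurs almost surely. Consider the event that from every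
  type, for every \<open>C\<close>, the weights reach \<open>C * exp (\<epsilon> * k)\<close> for some \<open>k\<close>. It has probability 0 or 1
  by Kolmogorov's law (\<open>all_unbounded_0_1\<close>). If it is 0, then the first case holds almost surely, since with positive
  probability all types of a level lead to type 1 (\<open>prob_unbounded_growth_zero\<close>). If it is 1, then
  most levels are the start of blocks of bounded length and growth rate \<open>\<epsilon>\<close>, for all types. Greedy
  tiling with these blocks (\<open>tiling\<close>) shows that for some \<open>n\<close> the best blocks of length \<open>n\<close> have a
  logarithmic weight with positive expectation, for the worst type. A strong law for these
  independent gains gives the second case. Letting \<open>s\<close> and \<open>\<epsilon>\<close> run through the positive rationals
  completes the proof.\<close>

section \<open>Hausdorff and box-counting dimension\<close>

lemma diam_powr_nonneg: "0 \<le> diam_powr s U"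
  by (simp add: diam_powr_def)

lemma covering_number_attained:
  fixes F :: "'a::euclidean_space set"
  assumes "bounded F" "0 < \<delta>"
  shows "\<exists>C. finite C \<and> card C = covering_number \<delta> F \<and> F \<subseteq> \<Union>C \<and>
    (\<forall>U\<in>C. bounded U \<and> diameter U \<le> \<delta>)"
proof -
  have "compact (closure F)"
    using assms(1) by (simp add: compact_closure)
  then obtain k where k: "finite k" "closure F \<subseteq> (\<Union>x\<in>k. ball x (\<delta>/2))"
    using assms(2) seq_compact_imp_totally_bounded[of "closure F"]
    unfolding compact_eq_seq_compact_metric by (meson half_gt_zero)
  have "\<exists>n C. finite C \<and> card C = n \<and> F \<subseteq> \<Union>C \<and> (\<forall>U\<in>C. bounded U \<and> diameter U \<le> \<delta>)"
  proof (intro exI conjI)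
    show "finite ((\<lambda>x. ball x (\<delta>/2)) ` k)" using k by simp
    show "F \<subseteq> \<Union> ((\<lambda>x. ball x (\<delta>/2)) ` k)" using k closure_subset by blast
    show "\<forall>U\<in>(\<lambda>x. ball x (\<delta>/2)) ` k. bounded U \<and> diameter U \<le> \<delta>"
      using assms(2) by (auto simp: diameter_ball)
  qed simp
  then show ?thesis
    unfolding covering_number_def by (rule LeastI_ex)
qed

lemma covering_number_le:
  assumes "finite C" "F \<subseteq> \<Union>C" "\<And>U. U \<in> C \<Longrightarrow> bounded U \<and> diameter U \<le> \<delta>"
  shows "covering_number \<delta> F \<le> card C"
  unfolding covering_number_def by (rule Least_le) (use assms in auto)

lemma hausdorff_premeasure_le_covering_number:
  fixes F :: "'a::euclidean_space set"
  assumes F: "bounded F" and \<delta>: "0 < \<delta>" "\<delta> \<le> \<delta>0" and t: "0 < t"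
  shows "hausdorff_premeasure t \<delta>0 F \<le> ennreal (real (covering_number \<delta> F) * \<delta> powr t)"
proof -
  obtain C where C: "finite C" "card C = covering_number \<delta> F" "F \<subseteq> \<Union>C"
    "\<forall>U\<in>C. bounded U \<and> diameter U \<le> \<delta>"
    using covering_number_attained[OF F \<delta>(1)] by blast
  obtain xs where xs: "set xs = C" "distinct xs"
    using finite_distinct_list[OF C(1)] by blast
  define U where "U = (\<lambda>i. if i < length xs then xs ! i else {})"
  have UC: "U i \<in> C" if "i < length xs" for i
    using that xs by (auto simp: U_def)
  have "F \<subseteq> (\<Union>i. U i)"
  proof
    fix x assume "x \<in> F"
    then obtain i where "i < length xs" "x \<in> xs ! i"
      using C(3) xs(1) by (metis UnionE in_mono in_set_conv_nth)
    then show "x \<in> (\<Union>i. U i)" by (auto simp: U_def)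
  qed
  moreover have "bounded (U i) \<and> diameter (U i) \<le> \<delta>0" for i
    using UC[of i] C(4) \<delta> by (cases "i < length xs") (force simp: U_def)+
  ultimately have "U \<in> delta_covers \<delta>0 F"
    by (simp add: delta_covers_def)
  then have "hausdorff_premeasure t \<delta>0 F \<le> (\<Sum>i. ennreal (diam_powr t (U i)))"
    unfolding hausdorff_premeasure_def by (rule INF_lower)
  also have "\<dots> = (\<Sum>i<length xs. ennreal (diam_powr t (U i)))"
    by (rule suminf_finite) (auto simp: U_def diam_powr_def)
  also have "\<dots> \<le> (\<Sum>i<length xs. ennreal (\<delta> powr t))"
  proof (intro sum_mono ennreal_leI)
    fix i assume "i \<in> {..<length xs}"
    then have "bounded (U i)" "diameter (U i) \<le> \<delta>" using UC C(4) by auto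
    then show "diam_powr t (U i) \<le> \<delta> powr t"
      using t diameter_ge_0[of "U i"] by (auto simp: diam_powr_def intro!: powr_mono2)
  qed
  also have "\<dots> = ennreal (real (covering_number \<delta> F) * \<delta> powr t)"
    using C(2) xs distinct_card[OF xs(2)] by (simp add: ennreal_mult ennreal_of_nat_eq_real_of_nat)
  finally show ?thesis .
qed

lemma box_ratio_nonneg: "\<delta> < 1 \<Longrightarrow> 0 < \<delta> \<Longrightarrow> 0 \<le> box_ratio F \<delta>"
  by (cases "covering_number \<delta> F = 0") (auto simp: box_ratio_def divide_nonneg_neg)

lemma Liminf_box_ratio_nonneg: "0 \<le> Liminf (at_right 0) (box_ratio F)"
proof (rule Liminf_bounded)
  show "\<forall>\<^sub>F \<delta> in at_right 0. 0 \<le> box_ratio F \<delta>"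
    using eventually_at_right_real[of 0 "1::real"]
    by (rule eventually_mono) (auto intro: box_ratio_nonneg)
qed

lemma hausdorff_dim_le_Liminf_box_ratio:
  fixes F :: "'a::euclidean_space set"
  assumes F: "bounded F"
  shows "hausdorff_dim F \<le> Liminf (at_right 0) (box_ratio F)"
proof (rule ereal_le_real)
  fix t assume "Liminf (at_right 0) (box_ratio F) \<le> ereal t"
  have *: "hausdorff_dim F \<le> ereal t" if less: "Liminf (at_right 0) (box_ratio F) < ereal t" for t
  proof -
    obtain u where u: "Liminf (at_right 0) (box_ratio F) < ereal u" "u < t"
      using less ereal_dense2 by (metis less_ereal.simps(1))
    then have "0 < u" "0 < t"
      using Liminf_box_ratio_nonneg[of F] by (auto dest: le_less_trans)
    have freq: "\<exists>\<delta>. 0 < \<delta> \<and> \<delta> < e \<and> box_ratio F \<delta> < ereal u" if e: "0 < e" for e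
    proof (rule ccontr)
      assume "\<not> ?thesis"
      then have ge: "ereal u \<le> box_ratio F \<delta>" if "0 < \<delta>" "\<delta> < e" for \<delta>
        using that by (meson not_less)
      then have "\<forall>\<^sub>F \<delta> in at_right 0. ereal u \<le> box_ratio F \<delta>"
        by (intro eventually_mono[OF eventually_at_right_real[OF e]] ge) auto
      then have "ereal u \<le> Liminf (at_right 0) (box_ratio F)" by (rule Liminf_bounded)
      with u show False by simp
    qed
    have small: "real (covering_number \<delta> F) * \<delta> powr t \<le> \<delta> powr (t - u)"
      if "0 < \<delta>" "\<delta> < 1" "box_ratio F \<delta> < ereal u" for \<delta>
    proof -
      have "real (covering_number \<delta> F) \<le> \<delta> powr (-u)"
      proof (cases "covering_number \<delta> F = 0")
        case False
        have "ln (real (covering_number \<delta> F)) \<le> u * (- ln \<delta>)"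
          using that by (simp add: box_ratio_def field_simps)
        then have "exp (ln (real (covering_number \<delta> F))) \<le> exp (u * (- ln \<delta>))"
          by (subst exp_le_cancel_iff)
        with False that show ?thesis by (simp add: powr_def)
      qed simp
      then have "real (covering_number \<delta> F) * \<delta> powr t \<le> \<delta> powr (-u) * \<delta> powr t"
        by (rule mult_right_mono) simp
      also have "\<dots> = \<delta> powr (t - u)" by (simp flip: powr_add)
      finally show ?thesis .
    qed
    have "hausdorff_premeasure t \<delta>0 F \<le> 0 + ennreal e" if \<delta>0: "0 < \<delta>0" and e: "0 < e" for \<delta>0 e :: real
    proof -
      have "((\<lambda>\<delta>::real. \<delta> powr (t - u)) \<longlongrightarrow> 0) (at_right 0)"
        using u by real_asymp
      then have "\<forall>\<^sub>F \<delta> in at_right 0. (\<delta>::real) powr (t - u) < e"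
        using e by (auto dest: order_tendstoD)
      then obtain e1 where e1: "0 < e1" "\<And>\<delta>::real. 0 < \<delta> \<Longrightarrow> \<delta> < e1 \<Longrightarrow> \<delta> powr (t - u) < e"
        by (auto simp: eventually_at_right_field)
      obtain \<delta> where \<delta>: "0 < \<delta>" "\<delta> < min (min e1 \<delta>0) 1" "box_ratio F \<delta> < ereal u"
        using freq[of "min (min e1 \<delta>0) 1"] e1 \<delta>0 by auto
      have "hausdorff_premeasure t \<delta>0 F \<le> ennreal (real (covering_number \<delta> F) * \<delta> powr t)"
        using \<delta> \<open>0 < t\<close> by (intro hausdorff_premeasure_le_covering_number[OF F]) auto
      also have "\<dots> \<le> ennreal e"
        using small[of \<delta>] e1(2)[of \<delta>] \<delta> by (intro ennreal_leI) auto
      finally show ?thesis by simp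
    qed
    then have "hausdorff_premeasure t \<delta>0 F = 0" if "0 < \<delta>0" for \<delta>0
      using that ennreal_le_epsilon[of 0 "hausdorff_premeasure t \<delta>0 F"] by simp
    then have "hausdorff_measure t F = 0"
      unfolding hausdorff_measure_def by (simp add: SUP_constant image_constant_conv)
    then show ?thesis
      unfolding hausdorff_dim_def using \<open>0 < t\<close> by (intro INF_lower) auto
  qed
  show "hausdorff_dim F \<le> ereal t"
  proof (rule ereal_le_epsilon2)
    fix e :: real assume "0 < e"
    then have "ereal t < ereal (t + e)" by simp
    then have "hausdorff_dim F \<le> ereal (t + e)"
      using \<open>Liminf (at_right 0) (box_ratio F) \<le> ereal t\<close> * le_less_trans by blast
    then show "hausdorff_dim F \<le> ereal t + ereal e" by simp
  qed
qed

text \<open>A discrete form of the mass distribution principle: instead of one measure on \<open>F\<close>, finitely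
  many point masses near \<open>F\<close> are given for every resolution \<open>D0\<close>. This suffices because a cover of
  the compact set \<open>F\<close> can be taken finite and open.\<close>

lemma discrete_mass_distribution:
  fixes F :: "'a::metric_space set"
  assumes F: "compact F" and s: "0 < s" and C: "0 < C"
    and mass: "\<And>D0 G. 0 < D0 \<Longrightarrow> open G \<Longrightarrow> F \<subseteq> G \<Longrightarrow>
      \<exists>(A :: 'b set) m pt. finite A \<and> (\<forall>a\<in>A. 0 \<le> m a \<and> pt a \<in> G) \<and> sum m A = 1 \<and>
        (\<forall>B D. D0 \<le> D \<longrightarrow> D < 1 \<longrightarrow> (\<forall>x\<in>B. \<forall>y\<in>B. dist x y \<le> D) \<longrightarrow>
          (\<Sum>a\<in>{a\<in>A. pt a \<in> B}. m a) \<le> C * D powr s)"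
  shows "ereal s \<le> hausdorff_dim F"
  unfolding hausdorff_dim_def
proof (rule INF_greatest)
  fix t assume "t \<in> {t. 0 \<le> t \<and> hausdorff_measure t F = 0}"
  then have t: "0 \<le> t" "hausdorff_measure t F = 0" by auto
  show "ereal s \<le> ereal t"
  proof (rule ccontr)
    assume "\<not> ereal s \<le> ereal t"
    then have ts: "t < s" by simp
    \<comment> \<open>chosen such that the total mass is at most \<open>2 * C * e = 1/2\<close>\<close>
    define e where "e = 1 / (4 * C)"
    have e: "0 < e" using C by (simp add: e_def)
    have "hausdorff_premeasure t (1/4) F \<le> hausdorff_measure t F"
      unfolding hausdorff_measure_def by (rule SUP_upper) simp
    then have "hausdorff_premeasure t (1/4) F < ennreal e"
      using t(2) e by simp
    then obtain U where U: "U \<in> delta_covers (1/4) F" "(\<Sum>i. ennreal (diam_powr t (U i))) < ennreal e"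
      unfolding hausdorff_premeasure_def INF_less_iff by blast
    have bU: "bounded (U i)" "diameter (U i) \<le> 1/4" for i
      using U(1) by (auto simp: delta_covers_def)
    have sumU: "(\<Sum>i\<in>I. diam_powr t (U i)) \<le> e" if "finite I" for I
    proof -
      have "ennreal (\<Sum>i\<in>I. diam_powr t (U i)) = (\<Sum>i\<in>I. ennreal (diam_powr t (U i)))"
        by (simp add: diam_powr_nonneg)
      also have "\<dots> \<le> (\<Sum>i. ennreal (diam_powr t (U i)))"
        using that by (intro sum_le_suminf) auto
      finally show ?thesis
        using U(2) e by (metis ennreal_le_iff le_less_trans less_imp_le)
    qed
    have pos: "0 \<le> diameter (U i)" for i using bU diameter_ge_0 by blast
    \<comment> \<open>the sets of the cover are enlarged to open sets of diameter at most \<open>D\<close>, at total extra cost \<open>e\<close>\<close>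
    have "\<exists>D. diameter (U i) < D \<and> D < 1 \<and> D powr s < diameter (U i) powr s + e * (1/2) ^ Suc i" for i
    proof -
      have "((\<lambda>x. x powr s) \<longlongrightarrow> diameter (U i) powr s) (at_right (diameter (U i)))"
      proof (rule tendsto_powr')
        show "diameter (U i) \<noteq> 0 \<or> 0 < s \<and> (\<forall>\<^sub>F x in at_right (diameter (U i)). 0 \<le> x)"
          using s pos[of i] eventually_mono[OF eventually_at_right_less[of "diameter (U i)"]]
          by fastforce
      qed (auto intro: tendsto_eq_intros)
      then have "\<forall>\<^sub>F x in at_right (diameter (U i)). x powr s < diameter (U i) powr s + e * (1/2) ^ Suc i"
        by (rule order_tendstoD) (use e in simp)
      moreover have "\<forall>\<^sub>F x in at_right (diameter (U i)). x \<in> {diameter (U i)<..<1}"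
        using bU(2)[of i] by (intro eventually_at_right_real) auto
      ultimately have "\<forall>\<^sub>F x in at_right (diameter (U i)). x powr s < diameter (U i) powr s + e * (1/2) ^ Suc i
          \<and> x \<in> {diameter (U i)<..<1}"
        by (rule eventually_conj)
      then show ?thesis
        using eventually_happens' trivial_limit_at_right_real by (metis (mono_tags, lifting) greaterThanLessThan_iff)
    qed
    then obtain D where D: "\<And>i. diameter (U i) < D i" "\<And>i. D i < 1"
      "\<And>i. D i powr s < diameter (U i) powr s + e * (1/2) ^ Suc i" by metis
    define G where "G = (\<lambda>i. \<Union>x\<in>U i. ball x ((D i - diameter (U i)) / 2))"
    have G_dist: "dist x y \<le> D i" if xy: "x \<in> G i" "y \<in> G i" for x y i
    proof -
      obtain a b where ab: "a \<in> U i" "b \<in> U i" "dist a x < (D i - diameter (U i)) / 2"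
        "dist b y < (D i - diameter (U i)) / 2" using xy by (auto simp: G_def)
      have "dist x y \<le> dist a x + dist a b + dist b y"
        by (smt (verit) dist_commute dist_triangle)
      moreover have "dist a b \<le> diameter (U i)"
        using ab bU by (intro diameter_bounded_bound)
      ultimately show ?thesis using ab by argo
    qed
    have "x \<in> G i" if "x \<in> U i" for x i
      unfolding G_def using that D(1)[of i] by (intro UN_I[of x]) auto
    then have "F \<subseteq> (\<Union>i. G i)" using U(1) unfolding delta_covers_def by blast
    moreover have "open (G i)" for i by (auto simp: G_def)
    ultimately obtain I where I: "finite I" "F \<subseteq> (\<Union>i\<in>I. G i)"
      using compactE_image[OF F, of UNIV G] by metis
    define D0 where "D0 = Min (insert (1/2) (D ` I))"
    have D0: "0 < D0" "\<And>i. i \<in> I \<Longrightarrow> D0 \<le> D i"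
      unfolding D0_def using I(1) pos D(1) by (auto intro: le_less_trans)
    have "open (\<Union>i\<in>I. G i)" using \<open>\<And>i. open (G i)\<close> by (rule open_UN[OF ballI])
    from mass[OF D0(1) this I(2)] obtain A :: "'b set" and m pt where
      A: "finite A" "\<forall>a\<in>A. 0 \<le> m a \<and> pt a \<in> (\<Union>i\<in>I. G i)" "sum m A = 1"
        "\<forall>B D. D0 \<le> D \<longrightarrow> D < 1 \<longrightarrow> (\<forall>x\<in>B. \<forall>y\<in>B. dist x y \<le> D) \<longrightarrow>
          (\<Sum>a\<in>{a\<in>A. pt a \<in> B}. m a) \<le> C * D powr s"
      by (elim exE conjE) (rule that)
    have "1 \<le> (\<Sum>a\<in>A. \<Sum>i\<in>I. if pt a \<in> G i then m a else 0)"
    proof -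
      have "m a \<le> (\<Sum>i\<in>I. if pt a \<in> G i then m a else 0)" if a: "a \<in> A" for a
      proof -
        obtain i where i: "i \<in> I" "pt a \<in> G i" using A(2) a by blast
        then show ?thesis
          using I(1) A(2) a member_le_sum[of i I "\<lambda>i. if pt a \<in> G i then m a else 0"] by auto
      qed
      then show ?thesis unfolding A(3)[symmetric] by (rule sum_mono)
    qed
    also have "\<dots> = (\<Sum>i\<in>I. \<Sum>a\<in>{a\<in>A. pt a \<in> G i}. m a)"
      by (subst sum.swap) (simp add: sum.inter_filter A(1))
    also have "\<dots> \<le> (\<Sum>i\<in>I. C * (diam_powr t (U i) + e * (1/2) ^ Suc i))"
    proof (rule sum_mono)
      fix i assume i: "i \<in> I"
      show "(\<Sum>a\<in>{a\<in>A. pt a \<in> G i}. m a) \<le> C * (diam_powr t (U i) + e * (1/2) ^ Suc i)"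
      proof (cases "U i = {}")
        case True
        then have "G i = {}" by (simp add: G_def)
        then show ?thesis using C e by (simp add: diam_powr_nonneg)
      next
        case False
        have "diameter (U i) powr s \<le> diam_powr t (U i)"
        proof (cases "t = 0 \<or> diameter (U i) = 0")
          case True
          then show ?thesis
            using False s pos[of i] bU(2)[of i] powr_le1[of s "diameter (U i)"]
            by (auto simp: diam_powr_def)
        next
          case False
          then show ?thesis
            using \<open>U i \<noteq> {}\<close> pos[of i] bU(2)[of i] ts by (auto simp: diam_powr_def intro!: powr_mono')
        qed
        then have "D i powr s \<le> diam_powr t (U i) + e * (1/2) ^ Suc i"
          using D(3)[of i] by linarith
        then show ?thesis
          using A(4)[rule_format, OF D0(2)[OF i] D(2), of "G i"] G_dist C
          by (meson less_imp_le mult_left_mono order_trans)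
      qed
    qed
    also have "\<dots> = C * ((\<Sum>i\<in>I. diam_powr t (U i)) + e * (\<Sum>i\<in>I. (1/2) ^ Suc i))"
      by (simp add: sum_distrib_left sum.distrib algebra_simps)
    also have "\<dots> \<le> C * (e + e * 1)"
    proof -
      have "(\<Sum>i\<in>I. (1/2::real) ^ Suc i) \<le> (\<Sum>i. (1/2) ^ Suc i)"
        using I(1) power_half_series by (intro sum_le_suminf) (auto simp: sums_iff)
      also have "\<dots> = 1" using power_half_series by (simp add: sums_iff)
      finally show ?thesis
        using C e sumU[OF I(1)] by (intro mult_left_mono add_mono) auto
    qed
    also have "\<dots> = 1/2" using C by (simp add: e_def field_simps)
    finally show False by simp
  qed
qed

text \<open>Scaling by \<open>1 / D\<close> reduces the bound to the total boundedness of one ball, so that the same \<open>n0\<close>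
  serves for all scales \<open>D\<close>.\<close>

lemma packing_bound:
  fixes \<alpha> \<beta> :: real
  assumes "0 < \<alpha>"
  shows "\<exists>n0. \<forall>D>0. \<forall>p. \<forall>P :: 'a::euclidean_space set. finite P \<longrightarrow>
    (\<forall>x\<in>P. dist p x \<le> \<beta> * D) \<longrightarrow> (\<forall>x\<in>P. \<forall>y\<in>P. x \<noteq> y \<longrightarrow> \<alpha> * D \<le> dist x y) \<longrightarrow> card P \<le> n0"
proof -
  have "seq_compact (cball (0::'a) \<beta>)"
    using compact_cball compact_eq_seq_compact_metric by blast
  then obtain k where k: "finite k" "cball (0::'a) \<beta> \<subseteq> (\<Union>x\<in>k. ball x (\<alpha>/2))"
    using seq_compact_imp_totally_bounded[of "cball (0::'a) \<beta>"] half_gt_zero[OF assms] by blast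
  have "card P \<le> card k"
    if D: "0 < D" and P: "\<forall>x\<in>P. dist p x \<le> \<beta> * D"
      "\<forall>x\<in>P. \<forall>y\<in>P. x \<noteq> y \<longrightarrow> \<alpha> * D \<le> dist x y" for D p and P :: "'a set"
  proof -
    define g where "g = (\<lambda>x. (1 / D) *\<^sub>R (x - p))"
    have g: "dist (g x) (g y) = dist x y / D" for x y
      using D by (simp add: g_def dist_norm flip: scaleR_diff_right)
    have "g x \<in> cball 0 \<beta>" if "x \<in> P" for x
    proof -
      have "norm (g x) = dist p x / D" using g[of p x] by (simp add: g_def dist_norm)
      also have "\<dots> \<le> \<beta>" using P(1) that D by (simp add: divide_le_eq)
      finally show ?thesis by simp
    qed
    then have "\<forall>x\<in>P. \<exists>c\<in>k. dist c (g x) < \<alpha>/2" using k(2) by fastforce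
    then obtain h where h: "\<And>x. x \<in> P \<Longrightarrow> h x \<in> k \<and> dist (h x) (g x) < \<alpha>/2" by metis
    have "inj_on h P"
    proof (rule inj_onI, rule ccontr)
      fix x y assume xy: "x \<in> P" "y \<in> P" "h x = h y" "x \<noteq> y"
      have "dist (g x) (g y) < \<alpha>"
        using h[OF xy(1)] h[OF xy(2)] dist_triangle2[of "g x" "g y" "h x"] xy(3)
        by (simp add: dist_commute)
      then show False using P(2) xy g[of x y] D by (force simp: field_simps)
    qed
    then show ?thesis using h k(1) by (intro card_inj_on_le) auto
  qed
  then show ?thesis by blast
qed

section \<open>Words of a realisation\<close>

text \<open>The similarity ratio of the map coded by a word, and the type reached at its end; both follow
  the recursion of \<^const>\<open>word_map\<close>.\<close>

fun word_ratio :: "('l \<Rightarrow> nat \<Rightarrow> real) \<Rightarrow> 'l realisation \<Rightarrow> nat \<Rightarrow> nat \<Rightarrow> nat list \<Rightarrow> real" where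
  "word_ratio \<rho> \<omega> l v [] = 1"
| "word_ratio \<rho> \<omega> l v (m # ms) =
     \<rho> (IFS_index \<omega> l v) m * word_ratio \<rho> \<omega> (Suc l) (next_type \<omega> l v m) ms"

fun end_type :: "'l realisation \<Rightarrow> nat \<Rightarrow> nat \<Rightarrow> nat list \<Rightarrow> nat" where
  "end_type \<omega> l v [] = v"
| "end_type \<omega> l v (m # ms) = end_type \<omega> (Suc l) (next_type \<omega> l v m) ms"

lemma admissible_append:
  "admissible M \<omega> l v (w @ u) \<longleftrightarrow>
     admissible M \<omega> l v w \<and> admissible M \<omega> (l + length w) (end_type \<omega> l v w) u"
  by (induction w arbitrary: l v) auto

lemma word_map_append:
  "word_map f \<omega> l v (w @ u) = word_map f \<omega> l v w \<circ> word_map f \<omega> (l + length w) (end_type \<omega> l v w) u"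
  by (induction w arbitrary: l v) auto

lemma word_ratio_append:
  "word_ratio \<rho> \<omega> l v (w @ u) =
     word_ratio \<rho> \<omega> l v w * word_ratio \<rho> \<omega> (l + length w) (end_type \<omega> l v w) u"
  by (induction w arbitrary: l v) auto

lemma end_type_append:
  "end_type \<omega> l v (w @ u) = end_type \<omega> (l + length w) (end_type \<omega> l v w) u"
  by (induction w arbitrary: l v) auto

text \<open>The choices made at a single level and type range over a finite set \<open>S\<close>. The closed ball of
  radius \<open>R\<close> around \<open>x0\<close> contains \<open>\<Delta>\<close>, and the ball is mapped into itself by every map of the family; its images
  under words serve as the cells of the construction. All ratios lie in \<open>{a..b}\<close>.\<close>

locale similarity_family =
  fixes S :: "('l \<times> (nat \<Rightarrow> nat)) set"
    and M :: "'l \<Rightarrow> nat"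
    and f :: "'l \<Rightarrow> nat \<Rightarrow> 'a::euclidean_space \<Rightarrow> 'a"
    and \<rho> :: "'l \<Rightarrow> nat \<Rightarrow> real"
    and V :: nat
    and \<Delta> :: "'a set"
    and x0 :: 'a
    and R a b :: real
  assumes finite_S: "finite S" and S_nonempty: "S \<noteq> {}"
    and M_pos: "\<And>c. c \<in> S \<Longrightarrow> 1 \<le> M (fst c)"
    and types: "\<And>c m. c \<in> S \<Longrightarrow> 1 \<le> m \<Longrightarrow> m \<le> M (fst c) \<Longrightarrow> snd c m \<in> {1..V}"
    and V_pos: "1 \<le> V"
    and similarity: "\<And>c m x y. c \<in> S \<Longrightarrow> 1 \<le> m \<Longrightarrow> m \<le> M (fst c) \<Longrightarrow>
      dist (f (fst c) m x) (f (fst c) m y) = \<rho> (fst c) m * dist x y"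
    and ratio_bounds: "\<And>c m. c \<in> S \<Longrightarrow> 1 \<le> m \<Longrightarrow> m \<le> M (fst c) \<Longrightarrow>
      a \<le> \<rho> (fst c) m \<and> \<rho> (fst c) m \<le> b"
    and ab: "0 < a" "a \<le> b" "b < 1"
    and R_pos: "0 < R"
    and ball_invariant: "\<And>c m. c \<in> S \<Longrightarrow> 1 \<le> m \<Longrightarrow> m \<le> M (fst c) \<Longrightarrow>
      dist (f (fst c) m x0) x0 \<le> (1 - \<rho> (fst c) m) * R"
    and \<Delta>_compact: "compact \<Delta>" and x0_in: "x0 \<in> \<Delta>" and \<Delta>_ball: "\<Delta> \<subseteq> cball x0 R"
    and \<Delta>_invariant: "\<And>c m. c \<in> S \<Longrightarrow> 1 \<le> m \<Longrightarrow> m \<le> M (fst c) \<Longrightarrow> f (fst c) m ` \<Delta> \<subseteq> \<Delta>"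
begin

text \<open>All choices belong to \<open>S\<close>, also at the positions that no word reads.\<close>

definition proper :: "'l realisation \<Rightarrow> bool" where
  "proper \<omega> \<longleftrightarrow> (\<forall>k v. \<omega> (k, v) \<in> S)"

abbreviation "adm \<equiv> admissible M"
abbreviation "ratio \<equiv> word_ratio \<rho>"

text \<open>The centre of the cell of a word; the cell is the ball of radius \<open>R * ratio\<close> around it.\<close>

definition centre :: "'l realisation \<Rightarrow> nat \<Rightarrow> nat \<Rightarrow> nat list \<Rightarrow> 'a" where
  "centre \<omega> i v w = word_map f \<omega> i v w x0"

text \<open>The admissible words of length \<open>k\<close> read from level \<open>i\<close> and type \<open>v\<close>.\<close>

definition words :: "'l realisation \<Rightarrow> nat \<Rightarrow> nat \<Rightarrow> nat \<Rightarrow> nat list set" where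
  "words \<omega> i v k = {w. length w = k \<and> adm \<omega> i v w}"

lemma word_map_dist:
  assumes "proper \<omega>" "adm \<omega> i v w"
  shows "dist (word_map f \<omega> i v w x) (word_map f \<omega> i v w y) = ratio \<omega> i v w * dist x y"
  using assms(2)
proof (induction w arbitrary: i v)
  case (Cons m w)
  have "\<omega> (i, v) \<in> S" using assms(1) by (simp add: proper_def)
  then show ?case
    using Cons similarity by (simp add: IFS_index_def algebra_simps)
qed simp

lemma letter_ratio:
  assumes "proper \<omega>" "adm \<omega> i v (m # w)"
  shows "a \<le> \<rho> (IFS_index \<omega> i v) m" "\<rho> (IFS_index \<omega> i v) m \<le> b"
  using assms ratio_bounds[of "\<omega> (i, v)" m] by (auto simp: proper_def IFS_index_def)

lemma ratio_between:
  assumes "proper \<omega>" "adm \<omega> i v w"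
  shows "a ^ length w \<le> ratio \<omega> i v w \<and> ratio \<omega> i v w \<le> b ^ length w"
  using assms(2)
proof (induction w arbitrary: i v)
  case (Cons m w)
  note IH = Cons.IH[of "Suc i" "next_type \<omega> i v m"] and \<rho> = letter_ratio[OF assms(1) Cons.prems]
  have "a ^ length w \<le> ratio \<omega> (Suc i) (next_type \<omega> i v m) w"
    using IH Cons.prems by simp
  moreover from this have "0 \<le> ratio \<omega> (Suc i) (next_type \<omega> i v m) w"
    using ab(1) by (meson less_imp_le order_trans zero_less_power)
  ultimately show ?case
    using IH Cons.prems \<rho> ab by (auto intro!: mult_mono)
qed simp

lemma ratio_pos: "proper \<omega> \<Longrightarrow> adm \<omega> i v w \<Longrightarrow> 0 < ratio \<omega> i v w"
  using ratio_between[of \<omega> i v w] ab(1) by (meson less_le_trans zero_less_power)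

lemma centre_near_x0:
  assumes "proper \<omega>" "adm \<omega> i v w"
  shows "dist (centre \<omega> i v w) x0 \<le> (1 - ratio \<omega> i v w) * R"
  using assms(2)
proof (induction w arbitrary: i v)
  case (Cons m w)
  let ?c = "\<omega> (i, v)" and ?v = "next_type \<omega> i v m"
  have c: "?c \<in> S" "1 \<le> m" "m \<le> M (fst ?c)" and w: "adm \<omega> (Suc i) ?v w"
    using assms(1) Cons.prems by (auto simp: proper_def IFS_index_def)
  have "dist (centre \<omega> i v (m # w)) x0 \<le>
      dist (f (fst ?c) m (centre \<omega> (Suc i) ?v w)) (f (fst ?c) m x0) + dist (f (fst ?c) m x0) x0"
    by (simp add: centre_def IFS_index_def dist_triangle)
  also have "\<dots> \<le> \<rho> (fst ?c) m * ((1 - ratio \<omega> (Suc i) ?v w) * R) + (1 - \<rho> (fst ?c) m) * R"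
    using similarity[OF c] ball_invariant[OF c] Cons.IH[OF w] ratio_bounds[OF c] ab
    by (auto intro!: add_mono mult_left_mono)
  also have "\<dots> = (1 - ratio \<omega> i v (m # w)) * R"
    by (simp add: IFS_index_def algebra_simps)
  finally show ?case .
qed (simp add: centre_def)

text \<open>The cell of a word contains the cells of all its extensions.\<close>

lemma centre_append_dist:
  assumes "proper \<omega>" "adm \<omega> i v (w @ u)"
  shows "dist (centre \<omega> i v (w @ u)) (centre \<omega> i v w) \<le> (ratio \<omega> i v w - ratio \<omega> i v (w @ u)) * R"
proof -
  let ?i = "i + length w" and ?v = "end_type \<omega> i v w"
  have w: "adm \<omega> i v w" and u: "adm \<omega> ?i ?v u" using assms(2) by (auto simp: admissible_append)
  have "dist (centre \<omega> i v (w @ u)) (centre \<omega> i v w) = ratio \<omega> i v w * dist (centre \<omega> ?i ?v u) x0"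
    unfolding centre_def word_map_append using word_map_dist[OF assms(1) w] by simp
  also have "\<dots> \<le> ratio \<omega> i v w * ((1 - ratio \<omega> ?i ?v u) * R)"
    using centre_near_x0[OF assms(1) u] ratio_pos[OF assms(1) w] by (intro mult_left_mono) auto
  finally show ?thesis by (simp add: word_ratio_append algebra_simps)
qed

lemma end_type_in:
  assumes "proper \<omega>" "adm \<omega> i v w" "v \<in> {1..V}"
  shows "end_type \<omega> i v w \<in> {1..V}"
  using assms(2,3)
proof (induction w arbitrary: i v)
  case (Cons m w)
  have "\<omega> (i, v) \<in> S" using assms(1) by (simp add: proper_def)
  then show ?case
    using Cons.prems types[of "\<omega> (i, v)" m]
    by (auto intro!: Cons.IH[simplified] simp: IFS_index_def next_type_def)
qed simp

lemma finite_words: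
  assumes "proper \<omega>"
  shows "finite (words \<omega> i v k)"
proof -
  define B where "B = Max ((\<lambda>c. M (fst c)) ` S)"
  have "set w \<subseteq> {..B}" if "adm \<omega> i v w" for i v w
    using that
  proof (induction w arbitrary: i v)
    case (Cons m w)
    have "M (fst (\<omega> (i, v))) \<le> B"
      unfolding B_def using assms finite_S by (intro Max_ge) (auto simp: proper_def)
    moreover have "set w \<subseteq> {..B}"
      using Cons.IH[of "Suc i" "next_type \<omega> i v m"] Cons.prems by simp
    ultimately show ?case using Cons.prems by (auto simp: IFS_index_def)
  qed simp
  then have "words \<omega> i v k \<subseteq> {w. set w \<subseteq> {..B} \<and> length w = k}"
    by (auto simp: words_def)
  then show ?thesis
    using finite_lists_length_eq[of "{..B}" k] finite_subset by blast
qed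

text \<open>The letter 1 is available at every level and type.\<close>

lemma first_letter_adm: "proper \<omega> \<Longrightarrow> adm \<omega> i v [1]"
  using M_pos[of "\<omega> (i, v)"] by (auto simp: proper_def IFS_index_def)

lemma adm_replicate_1: "proper \<omega> \<Longrightarrow> adm \<omega> i v (replicate k 1)"
  by (induction k arbitrary: i v) (use first_letter_adm in auto)

section \<open>Blocks of disjoint cells\<close>

text \<open>A block from level \<open>i\<close> and type \<open>v\<close> is a set of words of length \<open>k\<close> that end in a common type
  and whose open cells are pairwise disjoint, expressed by the distance of the centres. Blocks can
  be concatenated, whatever overlaps the maps have.\<close>

definition separated :: "'l realisation \<Rightarrow> nat \<Rightarrow> nat \<Rightarrow> nat list set \<Rightarrow> bool" where
  "separated \<omega> i v T \<longleftrightarrow> (\<forall>w\<in>T. \<forall>u\<in>T. w \<noteq> u \<longrightarrow>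
     (ratio \<omega> i v w + ratio \<omega> i v u) * R \<le> dist (centre \<omega> i v w) (centre \<omega> i v u))"

definition block :: "'l realisation \<Rightarrow> nat \<Rightarrow> nat \<Rightarrow> nat \<Rightarrow> nat \<Rightarrow> nat list set \<Rightarrow> bool" where
  "block \<omega> i v k v' T \<longleftrightarrow>
     T \<subseteq> words \<omega> i v k \<and> (\<forall>w\<in>T. end_type \<omega> i v w = v') \<and> separated \<omega> i v T"

text \<open>The weight of a block with exponent \<open>s\<close>, and the greatest weight of a block of length \<open>k\<close> from
  given level and type.\<close>

definition psum :: "real \<Rightarrow> 'l realisation \<Rightarrow> nat \<Rightarrow> nat \<Rightarrow> nat list set \<Rightarrow> real" where
  "psum s \<omega> i v T = (\<Sum>w\<in>T. ratio \<omega> i v w powr s)"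

definition max_psum :: "real \<Rightarrow> 'l realisation \<Rightarrow> nat \<Rightarrow> nat \<Rightarrow> nat \<Rightarrow> real" where
  "max_psum s \<omega> i v k = Max (psum s \<omega> i v ` {T. \<exists>v'. block \<omega> i v k v' T})"

definition concat_words :: "nat list set \<Rightarrow> nat list set \<Rightarrow> nat list set" where
  "concat_words T U = (\<lambda>(w, u). w @ u) ` (T \<times> U)"

lemma block_finite: "proper \<omega> \<Longrightarrow> block \<omega> i v k v' T \<Longrightarrow> finite T"
  unfolding block_def using finite_words finite_subset by blast

lemma block_adm: "block \<omega> i v k v' T \<Longrightarrow> w \<in> T \<Longrightarrow> length w = k \<and> adm \<omega> i v w \<and> end_type \<omega> i v w = v'"
  by (auto simp: block_def words_def)

text \<open>Cells that are disjoint stay so when the words are prolonged.\<close>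

lemma separated_prefixes:
  assumes \<omega>: "proper \<omega>" and adm: "adm \<omega> i v (w @ w')" "adm \<omega> i v (u @ u')"
    and sep: "(ratio \<omega> i v w + ratio \<omega> i v u) * R \<le> dist (centre \<omega> i v w) (centre \<omega> i v u)"
  shows "(ratio \<omega> i v (w @ w') + ratio \<omega> i v (u @ u')) * R
    \<le> dist (centre \<omega> i v (w @ w')) (centre \<omega> i v (u @ u'))"
proof -
  have "dist (centre \<omega> i v w) (centre \<omega> i v u) \<le>
      dist (centre \<omega> i v (w @ w')) (centre \<omega> i v w) +
      dist (centre \<omega> i v (w @ w')) (centre \<omega> i v (u @ u')) +
      dist (centre \<omega> i v (u @ u')) (centre \<omega> i v u)"
    by (smt (verit) dist_commute dist_triangle)
  then show ?thesis
    using centre_append_dist[OF \<omega> adm(1)] centre_append_dist[OF \<omega> adm(2)] sep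
    by (simp add: algebra_simps)
qed

lemma block_concat:
  assumes \<omega>: "proper \<omega>" and T: "block \<omega> i v k v' T" and U: "block \<omega> (i + k) v' n v'' U"
  shows "block \<omega> i v (k + n) v'' (concat_words T U)"
    and "psum s \<omega> i v (concat_words T U) = psum s \<omega> i v T * psum s \<omega> (i + k) v' U"
proof -
  have adm: "adm \<omega> i v (w @ u)" if "w \<in> T" "u \<in> U" for w u
    using block_adm[OF T that(1)] block_adm[OF U that(2)] by (auto simp: admissible_append)
  have "(ratio \<omega> i v (w @ u) + ratio \<omega> i v (w' @ u')) * R
      \<le> dist (centre \<omega> i v (w @ u)) (centre \<omega> i v (w' @ u'))"
    if *: "w \<in> T" "u \<in> U" "w' \<in> T" "u' \<in> U" "w @ u \<noteq> w' @ u'" for w u w' u'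
  proof (cases "w = w'")
    case False
    then show ?thesis
      using * T adm by (intro separated_prefixes[OF \<omega>]) (auto simp: block_def separated_def)
  next
    case True
    note w = block_adm[OF T that(1)]
    have "u \<noteq> u'" using True *(5) by auto
    then have "ratio \<omega> i v w * ((ratio \<omega> (i + k) v' u + ratio \<omega> (i + k) v' u') * R)
       \<le> ratio \<omega> i v w * dist (centre \<omega> (i + k) v' u) (centre \<omega> (i + k) v' u')"
      using U * ratio_pos[OF \<omega>, of i v w] w
      by (intro mult_left_mono) (auto simp: block_def separated_def)
    also have "\<dots> = dist (centre \<omega> i v (w @ u)) (centre \<omega> i v (w @ u'))"
      using w word_map_dist[OF \<omega>, of i v w] by (simp add: centre_def word_map_append)
    finally show ?thesis
      using w by (simp add: True[symmetric] word_ratio_append algebra_simps)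
  qed
  then show "block \<omega> i v (k + n) v'' (concat_words T U)"
    using block_adm[OF T] block_adm[OF U] adm
    by (auto simp: block_def words_def separated_def concat_words_def end_type_append)
  have "inj_on (\<lambda>(w, u). w @ u) (T \<times> U)"
    using block_adm[OF T] by (auto simp: inj_on_def)
  then have "psum s \<omega> i v (concat_words T U) = (\<Sum>(w, u)\<in>T \<times> U. ratio \<omega> i v (w @ u) powr s)"
    unfolding psum_def concat_words_def by (subst sum.reindex) (auto simp: case_prod_beta)
  also have "\<dots> = (\<Sum>(w, u)\<in>T \<times> U. ratio \<omega> i v w powr s * ratio \<omega> (i + k) v' u powr s)"
  proof (intro sum.cong refl, clarify)
    fix w u assume "w \<in> T" "u \<in> U"
    then show "ratio \<omega> i v (w @ u) powr s = ratio \<omega> i v w powr s * ratio \<omega> (i + k) v' u powr s"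
      using block_adm[OF T] block_adm[OF U] ratio_pos[OF \<omega>]
      by (metis less_imp_le powr_mult word_ratio_append)
  qed
  also have "\<dots> = psum s \<omega> i v T * psum s \<omega> (i + k) v' U"
    unfolding psum_def by (simp add: sum_product sum.cartesian_product)
  finally show "psum s \<omega> i v (concat_words T U) = psum s \<omega> i v T * psum s \<omega> (i + k) v' U" .
qed

lemma finite_blocks: "proper \<omega> \<Longrightarrow> finite {T. \<exists>v'. block \<omega> i v k v' T}"
  by (rule finite_subset[of _ "Pow (words \<omega> i v k)"]) (auto simp: block_def finite_words)

lemma max_psum_ge: "proper \<omega> \<Longrightarrow> block \<omega> i v k v' T \<Longrightarrow> psum s \<omega> i v T \<le> max_psum s \<omega> i v k"
  unfolding max_psum_def using finite_blocks by (intro Max_ge) auto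

lemma max_psum_attained:
  assumes "proper \<omega>"
  obtains v' T where "block \<omega> i v k v' T" "psum s \<omega> i v T = max_psum s \<omega> i v k"
proof -
  have "block \<omega> i v k v {}" by (simp add: block_def separated_def)
  then have "max_psum s \<omega> i v k \<in> psum s \<omega> i v ` {T. \<exists>v'. block \<omega> i v k v' T}"
    unfolding max_psum_def using finite_blocks[OF assms] by (intro Max_in) auto
  then show ?thesis using that by auto
qed

lemma singleton_block:
  assumes "proper \<omega>" "adm \<omega> i v w"
  shows "block \<omega> i v (length w) (end_type \<omega> i v w) {w}"
  using assms by (simp add: block_def words_def separated_def)

lemma max_psum_superadditive:
  assumes "proper \<omega>" "block \<omega> i v k v' T"
  shows "psum s \<omega> i v T * max_psum s \<omega> (i + k) v' n \<le> max_psum s \<omega> i v (k + n)"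
proof -
  obtain v'' U where U: "block \<omega> (i + k) v' n v'' U" "psum s \<omega> (i + k) v' U = max_psum s \<omega> (i + k) v' n"
    using max_psum_attained[OF assms(1)] by blast
  show ?thesis
    using block_concat[OF assms U(1)] max_psum_ge[OF assms(1)] U(2) by metis
qed

lemma max_psum_lower:
  assumes "proper \<omega>" "0 \<le> s"
  shows "(a powr s) ^ k \<le> max_psum s \<omega> i v k"
proof -
  let ?w = "replicate k (1::nat)"
  have "(a powr s) ^ k = (a powr s) powr real k"
    using ab by (intro powr_realpow[symmetric]) simp
  also have "\<dots> = (a powr real k) powr s"
    by (simp add: powr_powr mult.commute)
  also have "\<dots> = (a ^ k) powr s"
    using ab by (simp add: powr_realpow)
  also have "\<dots> \<le> psum s \<omega> i v {?w}"
    using ratio_between[OF assms(1) adm_replicate_1[OF assms(1)], of k i v] assms ab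
    by (auto simp: psum_def intro!: powr_mono2)
  also have "\<dots> \<le> max_psum s \<omega> i v k"
    using singleton_block[OF assms(1) adm_replicate_1[OF assms(1)]]
    by (intro max_psum_ge[OF assms(1)]) (auto simp: length_replicate)
  finally show ?thesis .
qed

lemma max_psum_pos: "proper \<omega> \<Longrightarrow> 0 \<le> s \<Longrightarrow> 0 < max_psum s \<omega> i v k"
  by (rule less_le_trans[OF _ max_psum_lower]) (use ab in auto)

lemma max_psum_Suc:
  assumes "proper \<omega>" "0 \<le> s"
  shows "a powr s * max_psum s \<omega> (Suc i) (next_type \<omega> i v 1) n \<le> max_psum s \<omega> i v (Suc n)"
proof -
  have 1: "block \<omega> i v 1 (next_type \<omega> i v 1) {[1]}"
    using singleton_block[OF assms(1) first_letter_adm[OF assms(1)], of i v] by simp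
  have "a \<le> ratio \<omega> i v [1]"
    using ratio_between[OF assms(1) first_letter_adm[OF assms(1)], of i v] by simp
  then have "a powr s \<le> psum s \<omega> i v {[1]}"
    using assms ab by (auto simp: psum_def intro!: powr_mono2)
  then have "a powr s * max_psum s \<omega> (Suc i) (next_type \<omega> i v 1) n \<le>
      psum s \<omega> i v {[1]} * max_psum s \<omega> (Suc i) (next_type \<omega> i v 1) n"
    using max_psum_pos[OF assms, of "Suc i" "next_type \<omega> i v 1" n] by (intro mult_right_mono) auto
  also have "\<dots> \<le> max_psum s \<omega> i v (Suc n)"
    using max_psum_superadditive[OF assms(1) 1, of s n] by simp
  finally show ?thesis .
qed

text \<open>The words read from a level depend only on the choices made from that level on, for as many
  levels as the word is long; the levels may be renumbered.\<close>

lemma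
  assumes \<omega>': "proper \<omega>'" and eq: "\<And>l u. l < k \<Longrightarrow> u \<in> {1..V} \<Longrightarrow> \<omega> (i + l, u) = \<omega>' (i' + l, u)"
    and w: "length w \<le> k" and v: "v \<in> {1..V}"
  shows adm_cong: "adm \<omega> i v w \<longleftrightarrow> adm \<omega>' i' v w"
    and word_map_cong: "adm \<omega>' i' v w \<Longrightarrow> word_map f \<omega> i v w = word_map f \<omega>' i' v w"
    and ratio_cong: "adm \<omega>' i' v w \<Longrightarrow> ratio \<omega> i v w = ratio \<omega>' i' v w"
    and end_type_cong: "adm \<omega>' i' v w \<Longrightarrow> end_type \<omega> i v w = end_type \<omega>' i' v w"
proof -
  have "(adm \<omega> i v w \<longleftrightarrow> adm \<omega>' i' v w) \<and> (adm \<omega>' i' v w \<longrightarrow>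
      word_map f \<omega> i v w = word_map f \<omega>' i' v w \<and> ratio \<omega> i v w = ratio \<omega>' i' v w \<and>
      end_type \<omega> i v w = end_type \<omega>' i' v w)"
    using eq w v
  proof (induction w arbitrary: i i' v k)
    case (Cons m w)
    then obtain k' where k: "k = Suc k'" by (cases k) auto
    have "\<omega> (i, v) = \<omega>' (i', v)"
      using Cons.prems(1)[of 0 v] Cons.prems(3) k by simp
    then have 0: "IFS_index \<omega> i v = IFS_index \<omega>' i' v" "next_type \<omega> i v = next_type \<omega>' i' v"
      by (auto simp: IFS_index_def next_type_def)
    show ?case
    proof (cases "1 \<le> m \<and> m \<le> M (IFS_index \<omega>' i' v)")
      case True
      then have t: "next_type \<omega>' i' v m \<in> {1..V}"
        using types[of "\<omega>' (i', v)" m] \<omega>' by (simp add: proper_def next_type_def IFS_index_def)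
      have "\<omega> (Suc i + l, u) = \<omega>' (Suc i' + l, u)" if "l < k'" "u \<in> {1..V}" for l u
        using Cons.prems(1)[of "Suc l" u] that k by simp
      then show ?thesis
        using Cons.IH[of k' "Suc i" "Suc i'" "next_type \<omega>' i' v m"] t Cons.prems(2) 0 k
        by auto
    qed (auto simp: 0)
  qed simp
  then show "adm \<omega> i v w \<longleftrightarrow> adm \<omega>' i' v w"
    "adm \<omega>' i' v w \<Longrightarrow> word_map f \<omega> i v w = word_map f \<omega>' i' v w"
    "adm \<omega>' i' v w \<Longrightarrow> ratio \<omega> i v w = ratio \<omega>' i' v w"
    "adm \<omega>' i' v w \<Longrightarrow> end_type \<omega> i v w = end_type \<omega>' i' v w" by auto
qed

lemma max_psum_cong:
  assumes \<omega>': "proper \<omega>'" and eq: "\<And>l u. l < k \<Longrightarrow> u \<in> {1..V} \<Longrightarrow> \<omega> (i + l, u) = \<omega>' (i' + l, u)"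
    and v: "v \<in> {1..V}"
  shows "max_psum s \<omega> i v k = max_psum s \<omega>' i' v k"
proof -
  note cong = adm_cong[OF \<omega>' eq _ v] word_map_cong[OF \<omega>' eq _ v] ratio_cong[OF \<omega>' eq _ v]
    end_type_cong[OF \<omega>' eq _ v]
  have words: "words \<omega> i v k = words \<omega>' i' v k"
    using cong(1) by (auto simp: words_def)
  have *: "ratio \<omega> i v w = ratio \<omega>' i' v w" "centre \<omega> i v w = centre \<omega>' i' v w"
    "end_type \<omega> i v w = end_type \<omega>' i' v w" if "w \<in> words \<omega>' i' v k" for w
    using that cong(2-4) by (auto simp: words_def centre_def)
  have "block \<omega> i v k v' T = block \<omega>' i' v k v' T" for v' T
    using * by (auto simp: block_def words separated_def subset_iff)
  moreover have "psum s \<omega> i v T = psum s \<omega>' i' v T" if "block \<omega>' i' v k v' T" for v' T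
    using that * by (auto simp: psum_def block_def intro!: sum.cong)
  ultimately show ?thesis
    unfolding max_psum_def by (intro arg_cong[of _ _ Max] image_cong) auto
qed

end

section \<open>The attractor and its cells\<close>

context similarity_family
begin

abbreviation "attractor \<equiv> V_variable_attractor M f \<Delta>"

text \<open>The \<open>k\<close>-th compact set of the decreasing sequence with intersection the attractor.\<close>

definition stage :: "'l realisation \<Rightarrow> nat \<Rightarrow> 'a set" where
  "stage \<omega> k = (\<Union>w\<in>words \<omega> 1 1 k. word_map f \<omega> 1 1 w ` \<Delta>)"

lemma attractor_eq: "attractor \<omega> = (\<Inter>k. stage \<omega> (Suc k))"
proof -
  have "attractor \<omega> = (\<Inter>k\<in>{1..}. stage \<omega> k)"
    by (simp add: V_variable_attractor_def typed_attractor_def stage_def words_def)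
  also have "{1..} = range Suc" by (auto simp: image_iff Suc_le_eq gr0_conv_Suc)
  finally show ?thesis by simp
qed

lemma word_map_\<Delta>:
  assumes "proper \<omega>" "adm \<omega> i v w"
  shows "word_map f \<omega> i v w ` \<Delta> \<subseteq> \<Delta>"
  using assms(2)
proof (induction w arbitrary: i v)
  case (Cons m w)
  then have "f (IFS_index \<omega> i v) m ` \<Delta> \<subseteq> \<Delta>"
    using assms(1) \<Delta>_invariant[of "\<omega> (i, v)" m] by (simp add: proper_def IFS_index_def)
  moreover have "word_map f \<omega> (Suc i) (next_type \<omega> i v m) w ` \<Delta> \<subseteq> \<Delta>"
    using Cons by simp
  ultimately show ?case by (simp add: image_comp[symmetric]) blast
qed simp

lemma stage_compact:
  assumes "proper \<omega>"
  shows "compact (stage \<omega> k)"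
proof -
  have "compact (word_map f \<omega> 1 1 w ` \<Delta>)" if "w \<in> words \<omega> 1 1 k" for w
  proof (rule compact_continuous_image[OF _ \<Delta>_compact])
    have w: "adm \<omega> 1 1 w" using that by (simp add: words_def)
    have "(ratio \<omega> 1 1 w)-lipschitz_on \<Delta> (word_map f \<omega> 1 1 w)"
      using word_map_dist[OF assms w] ratio_pos[OF assms w] by (intro lipschitz_onI) auto
    then show "continuous_on \<Delta> (word_map f \<omega> 1 1 w)"
      by (rule lipschitz_on_continuous_on)
  qed
  then show ?thesis
    unfolding stage_def using finite_words[OF assms] by (intro compact_UN) auto
qed

lemma prefix_image:
  assumes "proper \<omega>" "adm \<omega> i v w"
  shows "word_map f \<omega> i v w ` \<Delta> \<subseteq> word_map f \<omega> i v (take k w) ` \<Delta>"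
proof -
  have w: "w = take k w @ drop k w" by simp
  then have adm: "adm \<omega> (i + length (take k w)) (end_type \<omega> i v (take k w)) (drop k w)"
    using assms(2) admissible_append by metis
  have "word_map f \<omega> i v w =
      word_map f \<omega> i v (take k w) \<circ> word_map f \<omega> (i + length (take k w)) (end_type \<omega> i v (take k w)) (drop k w)"
    using word_map_append w by metis
  then show ?thesis using word_map_\<Delta>[OF assms(1) adm] by auto
qed

lemma adm_take: "adm \<omega> i v w \<Longrightarrow> adm \<omega> i v (take k w)"
  using admissible_append[of M \<omega> i v "take k w" "drop k w"] by simp

lemma stage_antimono:
  assumes "proper \<omega>" "k \<le> l"
  shows "stage \<omega> l \<subseteq> stage \<omega> k"
proof
  fix x assume "x \<in> stage \<omega> l"
  then obtain w where w: "length w = l" "adm \<omega> 1 1 w" "x \<in> word_map f \<omega> 1 1 w ` \<Delta>"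
    by (auto simp: stage_def words_def)
  then have "x \<in> word_map f \<omega> 1 1 (take k w) ` \<Delta>" "take k w \<in> words \<omega> 1 1 k"
    using prefix_image[OF assms(1) w(2)] adm_take[OF w(2)] assms(2) by (auto simp: words_def)
  then show "x \<in> stage \<omega> k" by (auto simp: stage_def)
qed

lemma attractor_compact: "proper \<omega> \<Longrightarrow> compact (attractor \<omega>)"
  unfolding attractor_eq
  using stage_compact by (intro compact_Inter) auto

lemma stage_subset_nbhd:
  assumes "proper \<omega>" "open G" "attractor \<omega> \<subseteq> G"
  shows "\<exists>k. \<forall>l\<ge>k. stage \<omega> l \<subseteq> G"
proof (rule ccontr)
  assume "\<not> ?thesis"
  then have *: "\<exists>l\<ge>k. \<not> stage \<omega> l \<subseteq> G" for k by blast
  have "\<Inter>(range (\<lambda>k. stage \<omega> (Suc k) - G)) \<noteq> {}"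
  proof (rule compact_nest)
    show "compact (stage \<omega> (Suc n) - G)" for n
      using stage_compact[OF assms(1)] assms(2) by (rule compact_diff)
    show "stage \<omega> (Suc n) - G \<noteq> {}" for n
      using *[of "Suc n"] stage_antimono[OF assms(1), of "Suc n"] by blast
    show "stage \<omega> (Suc n) - G \<subseteq> stage \<omega> (Suc m) - G" if "m \<le> n" for m n
      using stage_antimono[OF assms(1), of "Suc m" "Suc n"] that by auto
  qed
  then show False using assms(3) unfolding attractor_eq by blast
qed

lemma centre_in_stage:
  assumes "w \<in> words \<omega> 1 1 k"
  shows "centre \<omega> 1 1 w \<in> stage \<omega> k"
  using assms x0_in by (auto simp: stage_def centre_def)

lemma cell_contains:
  assumes "proper \<omega>" "adm \<omega> i v w" "x \<in> word_map f \<omega> i v w ` \<Delta>"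
  shows "dist (centre \<omega> i v w) x \<le> ratio \<omega> i v w * R"
proof -
  obtain y where y: "y \<in> \<Delta>" "x = word_map f \<omega> i v w y" using assms(3) by blast
  then show ?thesis
    using word_map_dist[OF assms(1,2), of x0 y] \<Delta>_ball ratio_pos[OF assms(1,2)]
    by (auto simp: centre_def subset_iff intro!: mult_left_mono)
qed

text \<open>Reading a word in steps of \<open>n\<close> letters, the ratio is compared with \<open>D\<close> at the first step
  where it has dropped to at most \<open>D\<close>; it cannot have dropped below \<open>a ^ n * D\<close>.\<close>

lemma stopping_prefix:
  assumes \<omega>: "proper \<omega>" and w: "adm \<omega> i v w" "length w = N * n" "ratio \<omega> i v w \<le> D" and D: "0 < D" "D < 1"
  obtains j where "1 \<le> j" "j \<le> N" "ratio \<omega> i v (take (j * n) w) \<le> D"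
    "a ^ n * D \<le> ratio \<omega> i v (take (j * n) w)"
    "\<And>l. l < j \<Longrightarrow> D < ratio \<omega> i v (take (l * n) w)"
proof -
  let ?P = "\<lambda>j. ratio \<omega> i v (take (j * n) w) \<le> D"
  define j where "j = (LEAST j. ?P j)"
  have "?P N" using w by simp
  then have j: "?P j" "j \<le> N" unfolding j_def by (rule LeastI, rule Least_le)
  have less: "D < ratio \<omega> i v (take (l * n) w)" if "l < j" for l
    using not_less_Least[of l ?P] that unfolding j_def by simp
  have "j \<noteq> 0" using j(1) D by (auto simp: not_le intro!: gr0I)
  then obtain l where l: "j = Suc l" by (cases j) auto
  let ?p = "take (l * n) w" and ?q = "take n (drop (l * n) w)"
  have split: "take (j * n) w = ?p @ ?q" by (simp add: l take_add add.commute[of n])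
  have len: "length ?q \<le> n" by simp
  have "adm \<omega> i v (?p @ ?q)" using adm_take[OF w(1)] split by metis
  then have q: "adm \<omega> (i + length ?p) (end_type \<omega> i v ?p) ?q" by (simp only: admissible_append)
  have "a ^ n \<le> a ^ length ?q" using ab len by (intro power_decreasing) auto
  also have "\<dots> \<le> ratio \<omega> (i + length ?p) (end_type \<omega> i v ?p) ?q"
    using ratio_between[OF \<omega> q] by blast
  finally have "D * a ^ n \<le> ratio \<omega> i v ?p * ratio \<omega> (i + length ?p) (end_type \<omega> i v ?p) ?q"
    using less[of l] l D ab by (intro mult_mono) auto
  then have "a ^ n * D \<le> ratio \<omega> i v (take (j * n) w)"
    unfolding split word_ratio_append by (simp only: mult.commute)
  then show ?thesis
    using that[of j] j less \<open>j \<noteq> 0\<close> by simp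
qed

section \<open>Upper bound for the box dimension\<close>

lemma separated_net:
  assumes "finite A"
  obtains T where "T \<subseteq> A" "separated \<omega> i v T"
    "\<And>w. w \<in> A \<Longrightarrow> \<exists>u\<in>T. dist (centre \<omega> i v w) (centre \<omega> i v u) \<le> (ratio \<omega> i v w + ratio \<omega> i v u) * R
      \<or> u = w"
proof -
  let ?P = "\<lambda>T. T \<subseteq> A \<and> separated \<omega> i v T"
  have "?P {}" by (simp add: separated_def)
  moreover have "\<forall>T. ?P T \<longrightarrow> card T < Suc (card A)"
    using assms by (auto simp: less_Suc_eq_le card_mono)
  ultimately have "\<exists>T. ?P T \<and> (\<forall>U. ?P U \<longrightarrow> card U \<le> card T)"
    by (rule ex_has_greatest_nat)
  then obtain T where T0: "?P T \<and> (\<forall>U. ?P U \<longrightarrow> card U \<le> card T)" ..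
  then have T: "card U \<le> card T" if "?P U" for U
    using that by simp
  have TP: "?P T" using T0 by simp
  have "\<exists>u\<in>T. dist (centre \<omega> i v w) (centre \<omega> i v u) \<le> (ratio \<omega> i v w + ratio \<omega> i v u) * R \<or> u = w"
    if w: "w \<in> A" for w
  proof (rule ccontr)
    assume neg: "\<not> ?thesis"
    then have "w \<notin> T" by blast
    moreover have "?P (insert w T)"
      using neg TP w by (auto simp: separated_def not_le dist_commute add.commute less_imp_le)
    ultimately show False
      using T[of "insert w T"] finite_subset[of T A] TP assms by (auto simp: card_insert_disjoint)
  qed
  then show ?thesis using that TP by blast
qed

text \<open>The words stopped at ratio about \<open>r\<close> have bounded length, and for each length and end type a
  maximal separated subset already accounts for all of them.\<close>

lemma attractor_cover:
  assumes \<omega>: "proper \<omega>" and s: "0 < s" and \<epsilon>: "0 < \<epsilon>"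
    and bound: "\<And>k. 1 \<le> k \<Longrightarrow> max_psum s \<omega> 1 1 k \<le> C * exp (\<epsilon> * real k)"
    and r: "0 < r" "r < 1" and K: "b ^ K \<le> r" "1 \<le> K"
  shows "real (covering_number (6 * R * r) (attractor \<omega>)) \<le>
    real K * real V * (C * exp (\<epsilon> * real K) * (a * r) powr - s)"
proof -
  define A where "A = (\<lambda>k v'. {w \<in> words \<omega> 1 1 k. end_type \<omega> 1 1 w = v' \<and>
    a * r \<le> ratio \<omega> 1 1 w \<and> ratio \<omega> 1 1 w \<le> r})"
  have "\<exists>T. T \<subseteq> A k v' \<and> separated \<omega> 1 1 T \<and> (\<forall>w\<in>A k v'. \<exists>u\<in>T.
      dist (centre \<omega> 1 1 w) (centre \<omega> 1 1 u) \<le> (ratio \<omega> 1 1 w + ratio \<omega> 1 1 u) * R \<or> u = w)" for k v'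
  proof -
    have "finite (A k v')"
      by (rule finite_subset[OF _ finite_words[OF \<omega>, of 1 1 k]]) (auto simp: A_def)
    then show ?thesis by (rule separated_net[of _ \<omega> 1 1]) blast
  qed
  then obtain T where T: "\<And>k v'. T k v' \<subseteq> A k v'" "\<And>k v'. separated \<omega> 1 1 (T k v')"
    "\<And>k v' w. w \<in> A k v' \<Longrightarrow> \<exists>u\<in>T k v'.
      dist (centre \<omega> 1 1 w) (centre \<omega> 1 1 u) \<le> (ratio \<omega> 1 1 w + ratio \<omega> 1 1 u) * R \<or> u = w"
    by metis
  have block: "block \<omega> 1 1 k v' (T k v')" for k v'
    using T(1)[of k v'] T(2)[of k v'] by (auto simp: block_def A_def)
  have fin: "finite (T k v')" for k v' by (rule block_finite[OF \<omega> block])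
  have C: "0 < C"
    using bound[of 1] max_psum_pos[OF \<omega>, of s 1 1 1] s
      zero_less_mult_pos2[of C "exp \<epsilon>"] by (simp del: One_nat_def)
  have ar: "0 < a * r" using ab r by simp
  have card_T: "real (card (T k v')) \<le> C * exp (\<epsilon> * real K) * (a * r) powr - s"
    if k: "1 \<le> k" "k \<le> K" for k v'
  proof -
    have "real (card (T k v')) * (a * r) powr s = (\<Sum>w\<in>T k v'. (a * r) powr s)" by simp
    also have "\<dots> \<le> psum s \<omega> 1 1 (T k v')"
      unfolding psum_def using T(1)[of k v'] ar s by (intro sum_mono powr_mono2) (auto simp: A_def)
    also have "\<dots> \<le> C * exp (\<epsilon> * real k)"
      using max_psum_ge[OF \<omega> block] bound[OF k(1)] order_trans by blast
    also have "\<dots> \<le> C * exp (\<epsilon> * real K)" using C \<epsilon> k by simp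
    finally have "real (card (T k v')) \<le> C * exp (\<epsilon> * real K) / (a * r) powr s"
      using ar by (subst pos_le_divide_eq) auto
    then show ?thesis by (simp add: powr_minus divide_inverse)
  qed
  define U where "U = (\<Union>k\<in>{1..K}. \<Union>v'\<in>{1..V}. (\<lambda>u. cball (centre \<omega> 1 1 u) (3 * R * r)) ` T k v')"
  have "covering_number (6 * R * r) (attractor \<omega>) \<le> card U"
  proof (rule covering_number_le)
    show "finite U" using fin by (simp add: U_def)
    show "bounded B \<and> diameter B \<le> 6 * R * r" if "B \<in> U" for B
      using that R_pos r by (auto simp: U_def)
    show "attractor \<omega> \<subseteq> \<Union>U"
    proof
      fix x assume "x \<in> attractor \<omega>"
      then have "x \<in> stage \<omega> (Suc (K - 1))" unfolding attractor_eq by blast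
      then have "x \<in> stage \<omega> K" using K(2) by simp
      then obtain w where w: "length w = K * 1" "adm \<omega> 1 1 w" "x \<in> word_map f \<omega> 1 1 w ` \<Delta>"
        by (auto simp: stage_def words_def)
      have "ratio \<omega> 1 1 w \<le> r" using ratio_between[OF \<omega> w(2)] w(1) K by simp
      then obtain k where k: "1 \<le> k" "k \<le> K" "ratio \<omega> 1 1 (take (k * 1) w) \<le> r"
        "a ^ 1 * r \<le> ratio \<omega> 1 1 (take (k * 1) w)"
        using stopping_prefix[OF \<omega> w(2,1) _ r] by metis
      let ?w = "take k w"
      let ?v = "end_type \<omega> 1 1 ?w"
      have adm: "adm \<omega> 1 1 ?w" using adm_take w by blast
      have v: "?v \<in> {1..V}" using end_type_in[OF \<omega> adm] V_pos by simp
      have "?w \<in> A k ?v" using k w adm by (simp add: A_def words_def)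
      then obtain u where u: "u \<in> T k ?v"
        "dist (centre \<omega> 1 1 ?w) (centre \<omega> 1 1 u) \<le> (ratio \<omega> 1 1 ?w + ratio \<omega> 1 1 u) * R \<or> u = ?w"
        using T(3) by blast
      have ru: "0 \<le> ratio \<omega> 1 1 u" "ratio \<omega> 1 1 u \<le> r"
        using T(1) u(1) ar by (force simp: A_def)+
      have rw: "0 \<le> ratio \<omega> 1 1 ?w" "ratio \<omega> 1 1 ?w \<le> r" using k ratio_pos[OF \<omega> adm] by auto
      have "dist (centre \<omega> 1 1 ?w) x \<le> ratio \<omega> 1 1 ?w * R"
        using cell_contains[OF \<omega> adm] prefix_image[OF \<omega> w(2)] w(3) by blast
      also have "\<dots> \<le> r * R" using rw R_pos by simp
      finally have 1: "dist (centre \<omega> 1 1 ?w) x \<le> r * R" .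
      have "(ratio \<omega> 1 1 ?w + ratio \<omega> 1 1 u) * R \<le> (r + r) * R"
        using rw ru R_pos by (intro mult_right_mono add_mono) auto
      then have "dist (centre \<omega> 1 1 ?w) (centre \<omega> 1 1 u) \<le> (r + r) * R"
        using u(2) r R_pos by (auto intro: order_trans)
      then have "dist (centre \<omega> 1 1 u) x \<le> 3 * R * r"
        using 1 dist_triangle3[of "centre \<omega> 1 1 u" x "centre \<omega> 1 1 ?w"] by (simp add: algebra_simps)
      moreover have "cball (centre \<omega> 1 1 u) (3 * R * r) \<in> U"
        unfolding U_def by (intro UN_I[of k] UN_I[of ?v] imageI) (use u(1) k(1,2) v in simp_all)
      ultimately show "x \<in> \<Union>U"
        by (intro UnionI[of "cball (centre \<omega> 1 1 u) (3 * R * r)"]) (auto simp del: One_nat_def)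
    qed
  qed
  also have "card U \<le> (\<Sum>k\<in>{1..K}. \<Sum>v'\<in>{1..V}. card (T k v'))"
    unfolding U_def using fin
    by (intro order_trans[OF card_UN_le sum_mono[OF order_trans[OF card_UN_le sum_mono[OF card_image_le]]]]) auto
  finally have "real (covering_number (6 * R * r) (attractor \<omega>)) \<le>
      (\<Sum>k\<in>{1..K}. \<Sum>v'\<in>{1..V}. real (card (T k v')))"
    by (simp flip: of_nat_sum)
  also have "\<dots> \<le> (\<Sum>k\<in>{1..K}. \<Sum>v'\<in>{1..V}. C * exp (\<epsilon> * real K) * (a * r) powr - s)"
    using card_T by (intro sum_mono) auto
  finally show ?thesis by simp
qed

text \<open>Subexponential weights with exponent \<open>s\<close> give box dimension at most about \<open>s\<close>: a word of ratio
  about \<open>r\<close> has at most \<open>1 + ln r / ln b\<close> letters, so the growth factor \<open>exp (\<epsilon> * K)\<close> is a power of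
  \<open>r\<close> with exponent of order \<open>\<epsilon>\<close>.\<close>

lemma upper_box_dim_le:
  assumes \<omega>: "proper \<omega>" and s: "0 < s" and \<epsilon>: "0 < \<epsilon>" and C: "1 \<le> C"
    and bound: "\<And>k. 1 \<le> k \<Longrightarrow> max_psum s \<omega> 1 1 k \<le> C * exp (\<epsilon> * real k)"
  shows "upper_box_dim (attractor \<omega>) \<le> ereal (s + \<epsilon> / - ln b)"
proof -
  define \<beta> where "\<beta> = - ln b"
  have b: "0 < b" "b < 1" using ab by auto
  have \<beta>: "0 < \<beta>" using b by (simp add: \<beta>_def)
  define c where "c = ln (6 * R)"
  define h where "h = (\<lambda>\<delta>::real. (ln ((- ln \<delta> + c) / \<beta> + 1) + ln (real V * C)
      + \<epsilon> * ((- ln \<delta> + c) / \<beta> + 1) + s * (- ln \<delta> + c - ln a)) / - ln \<delta>)"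
  have le: "box_ratio (attractor \<omega>) \<delta> \<le> ereal (h \<delta>)" if \<delta>: "0 < \<delta>" "\<delta> < min 1 (6 * R)" for \<delta>
  proof -
    \<comment> \<open>the covering balls have radius \<open>3 * R * r\<close>, hence diameter \<open>\<delta>\<close>\<close>
    define r where "r = \<delta> / (6 * R)"
    have r: "0 < r" "r < 1" "6 * R * r = \<delta>" using \<delta> R_pos by (auto simp: r_def)
    have lnr: "- ln r = - ln \<delta> + c" using \<delta> R_pos by (simp add: r_def c_def ln_div)
    define K where "K = nat \<lceil>- ln r / \<beta>\<rceil>"
    have pos: "0 < - ln r / \<beta>" using r \<beta> by (simp add: divide_neg_pos)
    have K: "- ln r / \<beta> \<le> real K" "real K \<le> - ln r / \<beta> + 1" "1 \<le> K"
      using pos unfolding K_def by linarith+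
    have "real K * ln b \<le> ln r" using K(1) \<beta> by (simp add: \<beta>_def field_simps)
    then have "exp (real K * ln b) \<le> exp (ln r)" by simp
    then have bK: "b ^ K \<le> r" using b r by (simp add: exp_of_nat_mult)
    let ?N = "real (covering_number \<delta> (attractor \<omega>))"
    let ?P = "real K * real V * (C * exp (\<epsilon> * real K) * (a * r) powr - s)"
    have N: "?N \<le> ?P"
      using attractor_cover[OF \<omega> s \<epsilon> bound r(1,2) bK K(3)] r(3) by simp
    have ar: "0 < a * r" "a * r < 1" using ab r mult_strict_mono[of a 1 r 1] by auto
    have "1 \<le> (a * r) powr - s"
      using ar s powr_mono'[of "-s" 0 "a * r"] powr_zero_eq_one[of "a * r"] by (smt (verit))
    then have P: "1 \<le> ?P"
      using K(3) V_pos C \<epsilon> by (intro mult_ge1_I) auto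
    have "ln ?N \<le> ln ?P"
    proof (cases "?N = 0")
      case True then show ?thesis using P by simp
    qed (use N P in simp)
    also have "ln ?P = ln (real K) + ln (real V * C) + \<epsilon> * real K + s * (- ln r - ln a)"
      using K(3) V_pos C ar ab r by (simp add: ln_mult ln_powr algebra_simps)
    also have "\<dots> \<le> ln (- ln r / \<beta> + 1) + ln (real V * C) + \<epsilon> * (- ln r / \<beta> + 1) + s * (- ln r - ln a)"
      using K \<epsilon> pos by (intro add_mono mult_left_mono order_refl) auto
    finally have "ln ?N / - ln \<delta> \<le> h \<delta>"
      unfolding h_def lnr using \<delta> by (intro divide_right_mono) auto
    then show ?thesis by (simp add: box_ratio_def)
  qed
  have "(h \<longlongrightarrow> \<epsilon> * inverse \<beta> + s) (at_right 0)"
    unfolding h_def using \<beta> \<epsilon> s by real_asymp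
  then have "(h \<longlongrightarrow> s + \<epsilon> / \<beta>) (at_right 0)"
    by (simp add: divide_inverse add.commute)
  then have lim: "((\<lambda>\<delta>. ereal (h \<delta>)) \<longlongrightarrow> ereal (s + \<epsilon> / \<beta>)) (at_right 0)"
    by simp
  have "\<forall>\<^sub>F \<delta> in at_right 0. \<delta> \<in> {0<..<min 1 (6 * R)}"
    using R_pos by (intro eventually_at_right_real) auto
  then have "\<forall>\<^sub>F \<delta> in at_right 0. box_ratio (attractor \<omega>) \<delta> \<le> ereal (h \<delta>)"
    by (rule eventually_mono) (use le in auto)
  then have "Limsup (at_right 0) (box_ratio (attractor \<omega>)) \<le> Limsup (at_right 0) (\<lambda>\<delta>. ereal (h \<delta>))"
    by (rule Limsup_mono)
  also have "\<dots> = ereal (s + \<epsilon> / \<beta>)" by (rule lim_imp_Limsup[OF _ lim]) simp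
  finally show ?thesis by (simp add: upper_box_dim_def \<beta>_def)
qed

end

section \<open>Lower bound for the Hausdorff dimension\<close>

context similarity_family
begin

lemma block_subset: "block \<omega> i v k v' T \<Longrightarrow> U \<subseteq> T \<Longrightarrow> block \<omega> i v k v' U"
  unfolding block_def separated_def by (meson subset_iff)

text \<open>Concatenating the blocks \<open>T 0, T 1, \<dots>\<close> gives the construction tree of a Cantor subset of the
  attractor.\<close>

primrec tree :: "(nat \<Rightarrow> nat list set) \<Rightarrow> nat \<Rightarrow> nat list set" where
  "tree T 0 = {[]}"
| "tree T (Suc J) = concat_words (tree T J) (T J)"

text \<open>The mass of a word of generation \<open>J\<close> is the \<open>s\<close>-th power of its ratio, divided by the product
  of the weights of the first \<open>J\<close> blocks. A set \<open>B\<close> of diameter at most \<open>D\<close> is tested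
  against the words stopped at ratio about \<open>D\<close>: their cells are disjoint, so that boundedly many of them meet \<open>B\<close>, and each of them
  carries a mass of at most \<open>D powr s / c\<close>.\<close>

lemma hausdorff_dim_ge:
  fixes v :: "nat \<Rightarrow> nat" and T :: "nat \<Rightarrow> nat list set"
  assumes \<omega>: "proper \<omega>" and s: "0 < s" and n: "1 \<le> n" and c: "0 < c" and v0: "v 0 = 1"
    and T: "\<And>j. block \<omega> (1 + j * n) (v j) n (v (Suc j)) (T j)"
    and Z: "\<And>J. c \<le> (\<Prod>j<J. psum s \<omega> (1 + j * n) (v j) (T j))"
  shows "ereal s \<le> hausdorff_dim (attractor \<omega>)"
proof -
  let ?r = "ratio \<omega> 1 1" and ?W = "tree T" and ?x = "centre \<omega> 1 1"
  let ?z = "\<lambda>j. psum s \<omega> (1 + j * n) (v j) (T j)"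
  let ?Z = "\<lambda>J. \<Prod>j<J. ?z j"
  have Zpos: "0 < ?Z J" for J using Z[of J] c by linarith
  have W: "block \<omega> 1 1 (J * n) (v J) (?W J) \<and> psum s \<omega> 1 1 (?W J) = ?Z J" for J
  proof (induction J)
    case 0
    show ?case by (simp add: block_def words_def separated_def psum_def v0)
  next
    case (Suc J)
    then have 1: "block \<omega> 1 1 (J * n) (v J) (?W J)" by simp
    show ?case
      using block_concat(1)[OF \<omega> 1 T] block_concat(2)[OF \<omega> 1 T, of s] Suc
      by (simp add: add.commute)
  qed
  note blockW = W[THEN conjunct1] and psumW = W[THEN conjunct2]
  have admW: "length w = J * n" "adm \<omega> 1 1 w" if "w \<in> ?W J" for w J
    using block_adm[OF blockW that] by auto
  have finW: "finite (?W J)" for J by (rule block_finite[OF \<omega> blockW])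
  have take_W: "take (j * n) w \<in> ?W j" if "w \<in> ?W J" "j \<le> J" for w J j
    using that
  proof (induction J arbitrary: w)
    case (Suc J)
    show ?case
    proof (cases "j = Suc J")
      case True
      then show ?thesis using Suc.prems admW(1)[OF Suc.prems(1)] by simp
    next
      case False
      obtain w1 w2 where w: "w = w1 @ w2" "w1 \<in> ?W J"
        using Suc.prems(1) by (auto simp: concat_words_def)
      have j: "j \<le> J" using False Suc.prems(2) by simp
      then have "j * n \<le> length w1" using admW(1)[OF w(2)] by simp
      then show ?thesis using Suc.IH[OF w(2) j] w(1) by simp
    qed
  qed simp
  \<comment> \<open>the total mass of the words of generation \<open>J\<close> below \<open>u\<close>, before normalisation by \<open>?Z J\<close>\<close>
  have below: "psum s \<omega> 1 1 {w \<in> ?W J. take (j * n) w = u} * ?Z j = ?r u powr s * ?Z J"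
    if u: "u \<in> ?W j" and "j \<le> J" for u j J
    using \<open>j \<le> J\<close>
  proof (induction J rule: dec_induct)
    case base
    have "{w \<in> ?W j. take (j * n) w = u} = {u}"
      using admW(1) u by (auto simp: take_all)
    then show ?case by (simp add: psum_def)
  next
    case (step J)
    let ?U = "{w \<in> ?W J. take (j * n) w = u}"
    have len: "j * n \<le> length w" if "w \<in> ?W J" for w
      using admW(1)[OF that] step by simp
    have "{w \<in> ?W (Suc J). take (j * n) w = u} = concat_words ?U (T J)"
      using len by (fastforce simp: concat_words_def image_iff)
    moreover have bU: "block \<omega> 1 1 (J * n) (v J) ?U"
      by (rule block_subset[OF blockW]) auto
    ultimately have "psum s \<omega> 1 1 {w \<in> ?W (Suc J). take (j * n) w = u} = psum s \<omega> 1 1 ?U * ?z J"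
      using block_concat(2)[OF \<omega> bU T, of s] by simp
    then show ?case using step.IH by (simp add: algebra_simps)
  qed
  define m where "m = (\<lambda>J w. ?r w powr s / ?Z J)"
  have "0 < 2 * R * a ^ n" using R_pos ab by simp
  from packing_bound[OF this, of "1 + R"] obtain n0 :: nat where
    n0_raw: "\<forall>D>0. \<forall>p. \<forall>P :: 'a set. finite P \<longrightarrow> (\<forall>x\<in>P. dist p x \<le> (1 + R) * D) \<longrightarrow>
      (\<forall>x\<in>P. \<forall>y\<in>P. x \<noteq> y \<longrightarrow> 2 * R * a ^ n * D \<le> dist x y) \<longrightarrow> card P \<le> n0" ..
  have n0: "card P \<le> n0" if "0 < D" "finite P" "\<forall>x\<in>P. dist p x \<le> (1 + R) * D"
      "\<forall>x\<in>P. \<forall>y\<in>P. x \<noteq> y \<longrightarrow> 2 * R * a ^ n * D \<le> dist x y" for D p and P :: "'a set"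
    using n0_raw that by blast
  have mass: "(\<Sum>w\<in>{w \<in> ?W J. ?x w \<in> B}. m J w) \<le> (real n0 + 1) / c * D powr s"
    if D: "0 < D" "D < 1" "b ^ (J * n) \<le> D" and B: "\<forall>x\<in>B. \<forall>y\<in>B. dist x y \<le> D" for J B D
  proof -
    let ?A = "{w \<in> ?W J. ?x w \<in> B}"
    let ?stop = "\<lambda>w j. j \<le> J \<and> ?r (take (j * n) w) \<le> D \<and> a ^ n * D \<le> ?r (take (j * n) w) \<and>
        (\<forall>l<j. D < ?r (take (l * n) w))"
    have "\<exists>j. ?stop w j" if w: "w \<in> ?A" for w
    proof -
      have w': "adm \<omega> 1 1 w" "length w = J * n" using w admW by auto
      then have "?r w \<le> D" using ratio_between[OF \<omega> w'(1)] D(3) by simp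
      from stopping_prefix[OF \<omega> w' this D(1,2)] show ?thesis by metis
    qed
    then have "\<exists>j. \<forall>w\<in>?A. ?stop w (j w)" by (intro bchoice ballI)
    then obtain j where stop: "\<forall>w\<in>?A. ?stop w (j w)" ..
    have j: "j w \<le> J" "?r (take (j w * n) w) \<le> D" "a ^ n * D \<le> ?r (take (j w * n) w)"
        "\<And>l. l < j w \<Longrightarrow> D < ?r (take (l * n) w)" if "w \<in> ?A" for w
      using bspec[OF stop that] by simp_all
    define q where "q = (\<lambda>w. take (j w * n) w)"
    have qW: "q w \<in> ?W (j w)" if "w \<in> ?A" for w
      unfolding q_def using take_W j(1)[OF that] that by blast
    have adm_q: "adm \<omega> 1 1 (q w)" if "w \<in> ?A" for w using admW(2) qW[OF that] by blast
    \<comment> \<open>stopped words are no proper prefixes of each other, so they separate in a common generation\<close>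
    have sep1: "(?r (q w) + ?r (q u)) * R \<le> dist (?x (q w)) (?x (q u))"
      if wu: "w \<in> ?A" "u \<in> ?A" "q w \<noteq> q u" and le: "j w \<le> j u" for w u
    proof -
      let ?p = "take (j w * n) u"
      have p: "?p \<in> ?W (j w)" using take_W j(1)[OF wu(1)] wu(2) by blast
      have qu: "q u = ?p @ drop (j w * n) (q u)"
        unfolding q_def by (metis append_take_drop_id le min.absorb1 mult_le_mono1 take_take)
      have "q w \<noteq> ?p"
      proof
        assume eq: "q w = ?p"
        then have "\<not> j w < j u" using j(4)[OF wu(2), of "j w"] j(2)[OF wu(1)] by (auto simp: q_def)
        then show False using eq le wu(3) by (simp add: q_def)
      qed
      then have "(?r (q w) + ?r ?p) * R \<le> dist (?x (q w)) (?x ?p)"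
        using blockW[of "j w"] qW[OF wu(1)] p by (auto simp: block_def separated_def)
      from separated_prefixes[OF \<omega> _ _ this, of "[]" "drop (j w * n) (q u)"]
      show ?thesis using adm_q[OF wu(1)] adm_q[OF wu(2)] qu by simp
    qed
    have sep: "(?r (q w) + ?r (q u)) * R \<le> dist (?x (q w)) (?x (q u))"
      if "w \<in> ?A" "u \<in> ?A" "q w \<noteq> q u" for w u
    proof (cases "j w \<le> j u")
      case True
      show ?thesis by (rule sep1[OF that True])
    next
      case False
      then show ?thesis
        using sep1[OF that(2,1) not_sym[OF that(3)]] by (simp only: add.commute dist_commute)
    qed
    have far: "2 * R * a ^ n * D \<le> dist (?x (q w)) (?x (q u))"
      if wu: "w \<in> ?A" "u \<in> ?A" "q w \<noteq> q u" for w u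
    proof -
      have "(a ^ n * D + a ^ n * D) * R \<le> (?r (q w) + ?r (q u)) * R"
        using j(3)[OF wu(1)] j(3)[OF wu(2)] R_pos unfolding q_def by (intro mult_right_mono add_mono) auto
      then show ?thesis using sep[OF wu] by (simp add: algebra_simps)
    qed
    have near: "dist (?x w) (?x (q w)) \<le> R * D" if w: "w \<in> ?A" for w
    proof -
      have "w = q w @ drop (j w * n) w" by (simp add: q_def)
      then have "dist (?x w) (?x (q w)) \<le> (?r (q w) - ?r w) * R"
        using centre_append_dist[OF \<omega>, of 1 1 "q w" "drop (j w * n) w"] admW(2) w by auto
      also have "\<dots> \<le> D * R"
        using j(2)[OF w] ratio_pos[OF \<omega>, of 1 1 w] admW(2) w R_pos
        by (intro mult_right_mono) (force simp: q_def)+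
      finally show ?thesis by (simp add: mult.commute)
    qed
    have finA: "finite ?A" using finW by simp
    have card: "card (q ` ?A) \<le> n0"
    proof (cases "?A = {}")
      case False
      then obtain w0 where w0: "w0 \<in> ?A" by blast
      have "inj_on ?x (q ` ?A)"
      proof (rule inj_onI)
        fix y y' assume "y \<in> q ` ?A" "y' \<in> q ` ?A" and eq: "?x y = ?x y'"
        then obtain w u where wu: "w \<in> ?A" "u \<in> ?A" "y = q w" "y' = q u" by blast
        have "0 < 2 * R * a ^ n * D" using R_pos ab D by simp
        then show "y = y'" using far[OF wu(1,2)] eq wu by (metis dist_self not_le)
      qed
      then have "card (q ` ?A) = card (?x ` q ` ?A)" by (simp add: card_image)
      also have "\<dots> \<le> n0"
      proof (rule n0[OF D(1), of _ "?x w0"])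
        show "finite (?x ` q ` ?A)" using finA by simp
        show "\<forall>x\<in>?x ` q ` ?A. dist (?x w0) x \<le> (1 + R) * D"
        proof safe
          fix w assume w: "w \<in> ?W J" "?x w \<in> B"
          have "dist (?x w0) (?x (q w)) \<le> dist (?x w0) (?x w) + dist (?x w) (?x (q w))"
            by (rule dist_triangle)
          also have "\<dots> \<le> D + R * D" using near[of w] B w w0 by (intro add_mono) auto
          finally show "dist (?x w0) (?x (q w)) \<le> (1 + R) * D" by (simp add: algebra_simps)
        qed
        show "\<forall>x\<in>?x ` q ` ?A. \<forall>y\<in>?x ` q ` ?A. x \<noteq> y \<longrightarrow> 2 * R * a ^ n * D \<le> dist x y"
          using far by fastforce
      qed
      finally show ?thesis .
    next
      case True
      then show ?thesis by (simp only: image_empty card.empty le0)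
    qed
    have part: "(\<Sum>w\<in>{w \<in> ?A. q w = y}. m J w) \<le> D powr s / c" if y: "y \<in> q ` ?A" for y
    proof -
      obtain u where u: "u \<in> ?A" "y = q u" using y by blast
      have jw: "j w = j u" if "w \<in> ?A" "q w = y" for w
      proof -
        have "length (q w) = j w * n" "length (q u) = j u * n"
          using admW(1) qW that(1) u(1) by blast+
        then show ?thesis using that u n by simp
      qed
      have "(\<Sum>w\<in>{w \<in> ?A. q w = y}. m J w) \<le> (\<Sum>w\<in>{w \<in> ?W J. take (j u * n) w = y}. m J w)"
        using jw finW Zpos by (intro sum_mono2) (auto simp: m_def q_def less_imp_le)
      also have "\<dots> = psum s \<omega> 1 1 {w \<in> ?W J. take (j u * n) w = y} / ?Z J"
        by (simp add: m_def psum_def sum_divide_distrib)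
      also have "\<dots> = ?r y powr s / ?Z (j u)"
        using below[OF qW[OF u(1)] j(1)[OF u(1)]] frac_eq_eq[OF Zpos[of J, THEN less_imp_neq, symmetric]
          Zpos[of "j u", THEN less_imp_neq, symmetric]] u(2) by (simp only:)
      also have "\<dots> \<le> D powr s / c"
        using j(2)[OF u(1)] ratio_pos[OF \<omega> adm_q[OF u(1)]] Z[of "j u"] c s u(2)
        by (intro frac_le powr_mono2) (auto simp: q_def)
      finally show ?thesis .
    qed
    have "(\<Sum>w\<in>?A. m J w) = (\<Sum>y\<in>q ` ?A. \<Sum>w\<in>{w \<in> ?A. q w = y}. m J w)"
      by (rule sum.image_gen[OF finA])
    also have "\<dots> \<le> (\<Sum>y\<in>q ` ?A. D powr s / c)" by (rule sum_mono) (rule part)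
    also have "\<dots> = real (card (q ` ?A)) * (D powr s / c)" by simp
    also have "\<dots> \<le> (real n0 + 1) * (D powr s / c)"
      using card c by (intro mult_right_mono) auto
    finally show ?thesis by simp
  qed
  show ?thesis
  proof (rule discrete_mass_distribution[where 'b = "nat list", OF attractor_compact[OF \<omega>] s])
    show "0 < (real n0 + 1) / c" using c by simp
    fix D0 :: real and G assume D0: "0 < D0" and G: "open G" "attractor \<omega> \<subseteq> G"
    obtain k where k: "\<And>l. k \<le> l \<Longrightarrow> stage \<omega> l \<subseteq> G" using stage_subset_nbhd[OF \<omega> G] by blast
    obtain l where l: "b ^ l < D0" using real_arch_pow_inv[OF D0] ab by auto
    define J where "J = max k l"
    have "J * 1 \<le> J * n" using n by (intro mult_le_mono2)
    then have J: "k \<le> J * n" "l \<le> J * n" by (auto simp: J_def)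
    have bJ: "b ^ (J * n) \<le> D0"
      using power_decreasing[OF J(2), of b] l ab by linarith
    show "\<exists>(A :: nat list set) m pt. finite A \<and> (\<forall>w\<in>A. 0 \<le> m w \<and> pt w \<in> G) \<and> sum m A = 1 \<and>
        (\<forall>B D. D0 \<le> D \<longrightarrow> D < 1 \<longrightarrow> (\<forall>x\<in>B. \<forall>y\<in>B. dist x y \<le> D) \<longrightarrow>
          (\<Sum>w\<in>{w \<in> A. pt w \<in> B}. m w) \<le> (real n0 + 1) / c * D powr s)"
    proof (intro exI conjI ballI allI impI)
      show "finite (?W J)" by (rule finW)
      show "0 \<le> m J w" if "w \<in> ?W J" for w using Zpos[of J] by (simp add: m_def less_imp_le)
      show "?x w \<in> G" if "w \<in> ?W J" for w
        using centre_in_stage[of w \<omega> "J * n"] k[OF J(1)] admW[OF that] by (auto simp: words_def)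
      have "sum (m J) (?W J) = psum s \<omega> 1 1 (?W J) / ?Z J"
        by (simp add: m_def psum_def sum_divide_distrib)
      then show "sum (m J) (?W J) = 1" using psumW[of J] divide_self[OF Zpos[of J, THEN less_imp_neq, symmetric]]
        by (simp only:)
      show "(\<Sum>w\<in>{w \<in> ?W J. ?x w \<in> B}. m J w) \<le> (real n0 + 1) / c * D powr s"
        if "D0 \<le> D" "D < 1" "\<forall>x\<in>B. \<forall>y\<in>B. dist x y \<le> D" for B D
        using that D0 bJ by (intro mass) auto
    qed
  qed
qed

end

section \<open>Long blocks by concatenation\<close>

context similarity_family
begin

text \<open>From every type at level \<open>i\<close> there starts a block of length at most \<open>K\<close> whose weight grows at
  rate \<open>\<epsilon>\<close>.\<close>

definition good_level :: "real \<Rightarrow> real \<Rightarrow> nat \<Rightarrow> nat \<Rightarrow> 'l realisation \<Rightarrow> bool" where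
  "good_level s \<epsilon> K i \<omega> \<longleftrightarrow> (\<forall>v\<in>{1..V}. \<exists>k\<in>{1..K}. exp (\<epsilon> * real k) \<le> max_psum s \<omega> i v k)"

lemma block_type_in:
  assumes "proper \<omega>" "block \<omega> i v k v' T" "0 < psum s \<omega> i v T" "v \<in> {1..V}"
  shows "v' \<in> {1..V}"
proof -
  have "T \<noteq> {}" using assms(3) by (auto simp: psum_def)
  then show ?thesis using block_adm[OF assms(2)] end_type_in[OF assms(1) _ assms(4)] by fastforce
qed

text \<open>Greedy tiling: at a good level a block of growth rate \<open>\<epsilon>\<close> is appended, at any other level a
  single letter. Each bad level costs at most the constant \<open>\<epsilon> - s * ln a\<close>, and so does each of the
  at most \<open>K\<close> last levels.\<close>

lemma tiling:
  assumes \<omega>: "proper \<omega>" and s: "0 < s" and \<epsilon>: "0 < \<epsilon>" and v: "v \<in> {1..V}"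
  shows "\<epsilon> * real n - (\<epsilon> - s * ln a) * real (card {l\<in>{i..<i + n}. \<not> good_level s \<epsilon> K l \<omega>})
      - (\<epsilon> - s * ln a) * real K \<le> ln (max_psum s \<omega> i v n)"
  using v
proof (induction n arbitrary: i v rule: less_induct)
  case (less n)
  define \<kappa> where "\<kappa> = \<epsilon> - s * ln a"
  have "ln a < 0" using ab by simp
  then have "s * ln a < 0" using s by (simp add: mult_pos_neg)
  then have \<kappa>: "0 \<le> \<kappa>" using \<epsilon> by (simp add: \<kappa>_def)
  let ?B = "\<lambda>i n. {l\<in>{i..<i + n}. \<not> good_level s \<epsilon> K l \<omega>}"
  have pos: "0 < max_psum s \<omega> j u m" for j u m using max_psum_pos[OF \<omega>] s by simp
  have "\<epsilon> * real n - \<kappa> * real (card (?B i n)) - \<kappa> * real K \<le> ln (max_psum s \<omega> i v n)"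
  proof (cases "n \<le> K")
    case True
    have "\<epsilon> * real n - \<kappa> * real n = ln ((a powr s) ^ n)"
      using ab by (simp add: \<kappa>_def ln_realpow ln_powr algebra_simps)
    also have "\<dots> \<le> ln (max_psum s \<omega> i v n)"
      using max_psum_lower[OF \<omega>, of s n i v] ab s pos by (subst ln_le_cancel_iff) auto
    finally have "\<epsilon> * real n - \<kappa> * real n \<le> ln (max_psum s \<omega> i v n)" .
    moreover have "\<kappa> * real n \<le> \<kappa> * real K" using True \<kappa> by (intro mult_left_mono) auto
    moreover have "0 \<le> \<kappa> * real (card (?B i n))" using \<kappa> by simp
    ultimately show ?thesis by linarith
  next
    case False
    show ?thesis
    proof (cases "good_level s \<epsilon> K i \<omega>")
      case True
      then obtain k where k: "1 \<le> k" "k \<le> K" "exp (\<epsilon> * real k) \<le> max_psum s \<omega> i v k"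
        using less.prems unfolding good_level_def by (meson atLeastAtMost_iff)
      obtain v' T where T: "block \<omega> i v k v' T" "psum s \<omega> i v T = max_psum s \<omega> i v k"
        using max_psum_attained[OF \<omega>] by blast
      have v': "v' \<in> {1..V}" using block_type_in[OF \<omega> T(1) _ less.prems, of s] T(2) pos by simp
      have "\<epsilon> * real (n - k) - \<kappa> * real (card (?B (i + k) (n - k))) - \<kappa> * real K
          \<le> ln (max_psum s \<omega> (i + k) v' (n - k))"
        using less.IH[OF _ v', of "n - k" "i + k"] k False by (simp add: \<kappa>_def)
      moreover have "card (?B (i + k) (n - k)) \<le> card (?B i n)"
        using k False by (intro card_mono) auto
      then have "\<kappa> * real (card (?B (i + k) (n - k))) \<le> \<kappa> * real (card (?B i n))"
        using \<kappa> by (intro mult_left_mono) auto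
      moreover have "\<epsilon> * real k + ln (max_psum s \<omega> (i + k) v' (n - k)) \<le> ln (max_psum s \<omega> i v n)"
      proof -
        have "exp (\<epsilon> * real k) * max_psum s \<omega> (i + k) v' (n - k) \<le>
            psum s \<omega> i v T * max_psum s \<omega> (i + k) v' (n - k)"
          using k(3) T(2) pos[of "i + k" v' "n - k"] by (intro mult_right_mono) auto
        also have "\<dots> \<le> max_psum s \<omega> i v (k + (n - k))"
          by (rule max_psum_superadditive[OF \<omega> T(1)])
        finally have "ln (exp (\<epsilon> * real k) * max_psum s \<omega> (i + k) v' (n - k)) \<le> ln (max_psum s \<omega> i v n)"
          using pos k False by (subst ln_le_cancel_iff) auto
        then show ?thesis using pos[of "i + k" v' "n - k"] by (simp add: ln_mult)
      qed
      moreover have "\<epsilon> * real n = \<epsilon> * real k + \<epsilon> * real (n - k)"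
        using k False by (simp add: of_nat_diff algebra_simps)
      ultimately show ?thesis by linarith
    next
      case bad: False
      let ?v = "next_type \<omega> i v 1"
      from False obtain n' where n': "n = Suc n'" by (cases n) auto
      have v': "?v \<in> {1..V}"
        using types[of "\<omega> (i, v)" 1] M_pos[of "\<omega> (i, v)"] \<omega> by (simp add: proper_def next_type_def)
      have IH: "\<epsilon> * real n' - \<kappa> * real (card (?B (Suc i) n')) - \<kappa> * real K
          \<le> ln (max_psum s \<omega> (Suc i) ?v n')"
        using less.IH[OF _ v', of n' "Suc i"] n' by (simp add: \<kappa>_def)
      have "?B i n = insert i (?B (Suc i) n')" using bad n' by (auto simp: Suc_le_eq le_less)
      then have card: "card (?B i n) = Suc (card (?B (Suc i) n'))" by simp
      have "ln (a powr s * max_psum s \<omega> (Suc i) ?v n') \<le> ln (max_psum s \<omega> i v n)"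
        using max_psum_Suc[OF \<omega>, of s i v n'] pos s ab n' by (subst ln_le_cancel_iff) auto
      moreover have "ln (a powr s * max_psum s \<omega> (Suc i) ?v n') = s * ln a + ln (max_psum s \<omega> (Suc i) ?v n')"
        using pos[of "Suc i" ?v n'] ab by (simp add: ln_mult ln_powr)
      moreover have "\<kappa> * real (card (?B i n)) = \<kappa> + \<kappa> * real (card (?B (Suc i) n'))"
        unfolding card by (simp add: distrib_left)
      moreover have "\<epsilon> * real n = \<epsilon> + \<epsilon> * real n'" by (simp add: n' distrib_left)
      ultimately show ?thesis using IH \<kappa>_def by linarith
    qed
  qed
  then show ?case by (simp add: \<kappa>_def)
qed

text \<open>The logarithmic gain of a maximal block of length \<open>n\<close> from the worst type at level \<open>i\<close>,
  truncated at \<open>\<epsilon> * n\<close> to have a bound that does not depend on the realisation.\<close>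

definition min_log_psum :: "real \<Rightarrow> real \<Rightarrow> nat \<Rightarrow> nat \<Rightarrow> 'l realisation \<Rightarrow> real" where
  "min_log_psum s \<epsilon> n i \<omega> = Min ((\<lambda>v. min (\<epsilon> * real n) (ln (max_psum s \<omega> i v n))) ` {1..V})"

lemma min_log_psum_le: "v \<in> {1..V} \<Longrightarrow> min_log_psum s \<epsilon> n i \<omega> \<le> ln (max_psum s \<omega> i v n)"
  unfolding min_log_psum_def by (rule order_trans[OF Min_le[of _ "min (\<epsilon> * real n) (ln (max_psum s \<omega> i v n))"]]) auto

lemma min_log_psum_bounds:
  assumes "proper \<omega>" "0 < s" "0 < \<epsilon>"
  shows "min_log_psum s \<epsilon> n i \<omega> \<in> {s * ln a * real n..\<epsilon> * real n}"
proof -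
  have "s * ln a * real n \<le> ln (max_psum s \<omega> i v n)" for v
  proof -
    have "s * ln a * real n = ln ((a powr s) ^ n)"
      using ab by (simp add: ln_realpow ln_powr)
    also have "\<dots> \<le> ln (max_psum s \<omega> i v n)"
      using max_psum_lower[OF assms(1), of s n i v] ab assms(2) max_psum_pos[OF assms(1), of s i v n]
      by (subst ln_le_cancel_iff) auto
    finally show ?thesis .
  qed
  moreover have "s * ln a * real n \<le> \<epsilon> * real n"
  proof (rule mult_right_mono)
    have "s * ln a < 0" using ab assms(2) by (simp add: mult_pos_neg)
    then show "s * ln a \<le> \<epsilon>" using assms(3) by simp
  qed simp
  moreover have "min_log_psum s \<epsilon> n i \<omega> \<le> \<epsilon> * real n"
    unfolding min_log_psum_def using V_pos
    by (intro order_trans[OF Min_le[of _ "min (\<epsilon> * real n) (ln (max_psum s \<omega> i 1 n))"]]) auto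
  ultimately show ?thesis
    using V_pos by (auto simp: min_log_psum_def)
qed

lemma min_log_psum_ge:
  assumes "proper \<omega>" "0 < s" "0 < \<epsilon>"
  shows "\<epsilon> * real n - (\<epsilon> - s * ln a) * real (card {l\<in>{i..<i + n}. \<not> good_level s \<epsilon> K l \<omega>})
      - (\<epsilon> - s * ln a) * real K \<le> min_log_psum s \<epsilon> n i \<omega>"
proof -
  have "s * ln a < 0" using ab assms(2) by (simp add: mult_pos_neg)
  then have "0 \<le> \<epsilon> - s * ln a" using assms(3) by simp
  then have "\<epsilon> * real n - (\<epsilon> - s * ln a) * real (card {l\<in>{i..<i + n}. \<not> good_level s \<epsilon> K l \<omega>})
      - (\<epsilon> - s * ln a) * real K \<le> \<epsilon> * real n"
    by (smt (verit) mult_nonneg_nonneg of_nat_0_le_iff)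
  then show ?thesis
    using V_pos tiling[OF assms] by (auto simp: min_log_psum_def)
qed

text \<open>If the partial sums of the logarithmic gains of consecutive blocks are eventually nonnegative, then
  maximal blocks can be chained to a Cantor subset of dimension at least \<open>s\<close>.\<close>

lemma hausdorff_dim_ge_of_sums:
  assumes \<omega>: "proper \<omega>" and s: "0 < s" and n: "1 \<le> n"
    and sums: "\<forall>\<^sub>F J in sequentially. 0 \<le> (\<Sum>j<J. min_log_psum s \<epsilon> n (1 + j * n) \<omega>)"
  shows "ereal s \<le> hausdorff_dim (attractor \<omega>)"
proof -
  let ?X = "\<lambda>j. min_log_psum s \<epsilon> n (1 + j * n) \<omega>"
  obtain J0 where J0: "\<And>J. J0 \<le> J \<Longrightarrow> 0 \<le> (\<Sum>j<J. ?X j)"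
    using sums by (auto simp: eventually_sequentially)
  define c where "c = Min ((\<lambda>J. \<Sum>j<J. ?X j) ` {..J0})"
  have c: "min c 0 \<le> (\<Sum>j<J. ?X j)" for J
  proof (cases "J \<le> J0")
    case True
    then have "c \<le> (\<Sum>j<J. ?X j)" unfolding c_def by (intro Min_le) auto
    then show ?thesis by simp
  qed (use J0[of J] in simp)
  let ?P = "\<lambda>j v p. block \<omega> (1 + j * n) v n (fst p) (snd p) \<and>
    psum s \<omega> (1 + j * n) v (snd p) = max_psum s \<omega> (1 + j * n) v n"
  define g where "g = (\<lambda>j v. SOME p. ?P j v p)"
  have g: "?P j v (g j v)" for j v
    unfolding g_def
  proof (rule someI_ex)
    obtain v' T where "block \<omega> (1 + j * n) v n v' T" "psum s \<omega> (1 + j * n) v T = max_psum s \<omega> (1 + j * n) v n"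
      using max_psum_attained[OF \<omega>] by blast
    then show "\<exists>p. ?P j v p" by (intro exI[of _ "(v', T)"]) simp
  qed
  define v where "v = rec_nat 1 (\<lambda>j u. fst (g j u))"
  define T where "T = (\<lambda>j. snd (g j (v j)))"
  have v: "v 0 = 1" "v (Suc j) = fst (g j (v j))" for j by (simp_all add: v_def)
  have T: "block \<omega> (1 + j * n) (v j) n (v (Suc j)) (T j)"
    "psum s \<omega> (1 + j * n) (v j) (T j) = max_psum s \<omega> (1 + j * n) (v j) n" for j
    using g[of j "v j"] by (simp_all add: T_def v(2))
  have vV: "v j \<in> {1..V}" for j
  proof (induction j)
    case 0
    then show ?case using V_pos v(1) by simp
  next
    case (Suc j)
    show ?case
      by (rule block_type_in[OF \<omega> T(1) _ Suc, of s]) (use T(2) max_psum_pos[OF \<omega>] s in simp)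
  qed
  have "exp (min c 0) \<le> (\<Prod>j<J. psum s \<omega> (1 + j * n) (v j) (T j))" for J
  proof -
    have "exp (min c 0) \<le> exp (\<Sum>j<J. ?X j)" using c by simp
    also have "\<dots> = (\<Prod>j<J. exp (?X j))" by (simp add: exp_sum)
    also have "\<dots> \<le> (\<Prod>j<J. psum s \<omega> (1 + j * n) (v j) (T j))"
    proof (rule prod_mono, intro conjI)
      fix j
      have "?X j \<le> ln (max_psum s \<omega> (1 + j * n) (v j) n)" by (rule min_log_psum_le[OF vV])
      then have "exp (?X j) \<le> exp (ln (max_psum s \<omega> (1 + j * n) (v j) n))" by (subst exp_le_cancel_iff)
      then show "exp (?X j) \<le> psum s \<omega> (1 + j * n) (v j) (T j)"
        using max_psum_pos[OF \<omega> less_imp_le[OF s], of "1 + j * n" "v j" n] unfolding T(2)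
        by (simp only: exp_ln)
    qed simp
    finally show ?thesis .
  qed
  then show ?thesis
    using hausdorff_dim_ge[OF \<omega> s n _ v(1) T(1), of "exp (min c 0)"] by simp
qed

end

section \<open>A strong law for bounded independent variables\<close>

text \<open>By Hoeffding's inequality the probabilities of the exceptional events decay geometrically, and
  the Borel-Cantelli lemma applies.\<close>

lemma (in prob_space) sums_eventually_nonneg:
  fixes X :: "nat \<Rightarrow> 'a \<Rightarrow> real"
  assumes indep: "indep_vars (\<lambda>_. borel) X UNIV"
    and bounds: "\<And>i x. x \<in> space M \<Longrightarrow> X i x \<in> {l..u}" and lu: "l < u"
    and \<mu>: "0 < \<mu>" and E: "\<And>i. \<mu> \<le> expectation (X i)"
  shows "AE x in M. \<forall>\<^sub>F n in sequentially. 0 \<le> (\<Sum>i<n. X i x)"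
proof -
  have X[measurable]: "random_variable borel (X i)" for i
    using indep by (simp add: indep_vars_def2)
  define B where "B = (\<lambda>n. {x \<in> space M. (\<Sum>i<n. X i x) \<le> 0})"
  define q where "q = exp (- 2 * \<mu>\<^sup>2 / (u - l)\<^sup>2)"
  have B: "prob (B n) \<le> q ^ n" for n
  proof (cases "n = 0")
    case False
    interpret H: Hoeffding_ineq M "{..<n}" X "\<lambda>_. l" "\<lambda>_. u" "\<Sum>i<n. expectation (X i)"
      using indep_vars_subset[OF indep, of "{..<n}"] bounds by unfold_locales auto
    have pos: "0 < (\<Sum>i<n. (u - l)\<^sup>2)" using False lu by simp
    have "real n * \<mu> = (\<Sum>i<n. \<mu>)" by simp
    also have "\<dots> \<le> (\<Sum>i<n. expectation (X i))" by (intro sum_mono E)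
    finally have le: "real n * \<mu> \<le> (\<Sum>i<n. expectation (X i))" .
    have "prob (B n) \<le> prob {x \<in> space M. (\<Sum>i<n. X i x) \<le> (\<Sum>i<n. expectation (X i)) - real n * \<mu>}"
      unfolding B_def using le by (intro finite_measure_mono) auto
    also have "\<dots> \<le> exp (- 2 * (real n * \<mu>)\<^sup>2 / (\<Sum>i<n. (u - l)\<^sup>2))"
      using \<mu> pos by (intro H.Hoeffding_ineq_le) auto
    also have "\<dots> = q ^ n"
    proof -
      have "(real n * \<mu>)\<^sup>2 / (\<Sum>i<n. (u - l)\<^sup>2) = real n * (\<mu>\<^sup>2 / (u - l)\<^sup>2)"
        using False by (simp add: power2_eq_square)
      then have "- 2 * (real n * \<mu>)\<^sup>2 / (\<Sum>i<n. (u - l)\<^sup>2) = real n * (- 2 * \<mu>\<^sup>2 / (u - l)\<^sup>2)"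
        by (simp only: times_divide_eq_right[symmetric] mult.left_commute)
      then show ?thesis by (simp only: q_def exp_of_nat_mult)
    qed
    finally show ?thesis .
  qed simp
  have "0 \<le> q" "q < 1" using \<mu> lu by (auto simp: q_def)
  then have "summable (\<lambda>n. prob (B n))"
    by (intro summable_comparison_test[OF _ summable_geometric[of q]]) (use B in auto)
  then have "AE x in M. \<forall>\<^sub>F n in sequentially. x \<in> space M - B n"
    by (intro borel_cantelli_AE1) (auto simp: B_def emeasure_eq_measure)
  then show ?thesis
    by (rule AE_mp) (auto simp: B_def elim!: eventually_mono intro!: AE_I2)
qed

section \<open>Events of the random realisation\<close>

text \<open>The possible choices are the support of the distribution of a single choice.\<close>

locale random_family = similarity_family S M f \<rho> V \<Delta> x0 R a b
  for S :: "('l \<times> (nat \<Rightarrow> nat)) set" and M and f :: "'l \<Rightarrow> nat \<Rightarrow> 'a::euclidean_space \<Rightarrow> 'a"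
    and \<rho> V \<Delta> x0 R a b +
  fixes p :: "'l pmf"
  assumes S_eq: "S = set_pmf (choice_pmf p M V)"
begin

abbreviation "\<P> \<equiv> realisation_measure p M V"
abbreviation "positions \<equiv> {1..} \<times> {1..V} :: (nat \<times> nat) set"

sublocale prob_space \<P>
  unfolding realisation_measure_def by (intro prob_space_PiM) (rule prob_space_measure_pmf)

text \<open>Replacing the choices outside the support changes a realisation only on a null set, and makes
  all of its values proper choices.\<close>

definition clip_choice :: "'l \<times> (nat \<Rightarrow> nat) \<Rightarrow> 'l \<times> (nat \<Rightarrow> nat)" where
  "clip_choice c = (if c \<in> S then c else (SOME c. c \<in> S))"

definition clip :: "'l realisation \<Rightarrow> 'l realisation" where
  "clip \<omega> = (\<lambda>h. clip_choice (\<omega> h))"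

lemma clip_choice_in: "clip_choice c \<in> S"
  using S_nonempty someI_ex[of "\<lambda>c. c \<in> S"] by (auto simp: clip_choice_def)

lemma proper_clip: "proper (clip \<omega>)"
  by (simp add: proper_def clip_def clip_choice_in)

lemma AE_clip: "AE \<omega> in \<P>. \<forall>h\<in>positions. \<omega> h = clip \<omega> h"
proof (subst AE_ball_countable)
  show "\<forall>h\<in>positions. AE \<omega> in \<P>. \<omega> h = clip \<omega> h"
  proof
    fix h assume h: "h \<in> positions"
    have "AE c in measure_pmf (choice_pmf p M V). c = clip_choice c"
      unfolding AE_measure_pmf_iff clip_choice_def S_eq[symmetric] by simp
    then have "AE \<omega> in \<P>. \<omega> h = clip_choice (\<omega> h)"
      unfolding realisation_measure_def using h
      by (intro AE_PiM_component[where M = "\<lambda>_. measure_pmf (choice_pmf p M V)"]) (auto simp: prob_space_measure_pmf)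
    then show "AE \<omega> in \<P>. \<omega> h = clip \<omega> h" by (simp add: clip_def)
  qed
qed simp

lemma attractor_clip:
  assumes "\<forall>h\<in>positions. \<omega> h = clip \<omega> h"
  shows "attractor \<omega> = attractor (clip \<omega>)"
proof -
  have eq: "\<omega> (1 + l, u) = clip \<omega> (1 + l, u)" if "u \<in> {1..V}" for l u
    using assms that by auto
  have 1: "1 \<in> {1..V}" using V_pos by simp
  have "adm \<omega> 1 1 w = adm (clip \<omega>) 1 1 w" for w
    by (rule adm_cong[OF proper_clip eq order_refl 1])
  moreover have "word_map f \<omega> 1 1 w = word_map f (clip \<omega>) 1 1 w" if "adm (clip \<omega>) 1 1 w" for w
    by (rule word_map_cong[OF proper_clip eq order_refl 1 that])
  ultimately show ?thesis
    unfolding attractor_eq stage_def words_def by simp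
qed

text \<open>The events determined by the choice at one position, and by the choices at a set of positions.\<close>

definition coordinate_events :: "nat \<times> nat \<Rightarrow> 'l realisation set set" where
  "coordinate_events h = {{\<omega> \<in> space \<P>. \<omega> h \<in> A} |A. True}"

definition events_of :: "(nat \<times> nat) set \<Rightarrow> 'l realisation set set" where
  "events_of H = sigma_sets (space \<P>) (\<Union>h\<in>H. coordinate_events h)"

abbreviation "levels A \<equiv> A \<times> {1..V} :: (nat \<times> nat) set"

lemma sigma_algebra_events_of: "sigma_algebra (space \<P>) (events_of H)"
  unfolding events_of_def by (rule sigma_algebra_sigma_sets) (auto simp: coordinate_events_def)

lemma events_of_mono: "H \<subseteq> H' \<Longrightarrow> events_of H \<subseteq> events_of H'"
  unfolding events_of_def by (intro sigma_sets_mono' UN_mono) auto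

lemma coordinate_measurable: "h \<in> positions \<Longrightarrow> (\<lambda>\<omega>. \<omega> h) \<in> \<P> \<rightarrow>\<^sub>M measure_pmf (choice_pmf p M V)"
  unfolding realisation_measure_def by (rule measurable_component_singleton)

lemma coordinate_events_subset: "h \<in> positions \<Longrightarrow> coordinate_events h \<subseteq> events"
  using measurable_sets[OF coordinate_measurable, of h]
  by (auto simp: coordinate_events_def vimage_def Int_def conj_commute)

lemma events_of_subset: "H \<subseteq> positions \<Longrightarrow> events_of H \<subseteq> events"
  unfolding events_of_def using coordinate_events_subset by (intro sets.sigma_sets_subset) blast

lemma indep_coordinate_events: "indep_sets coordinate_events positions"
proof -
  let ?Q = "measure_pmf (choice_pmf p M V)"
  have ne: "positions \<noteq> {}" using V_pos by auto
  have Q: "distr \<P> ?Q (\<lambda>\<omega>. \<omega> h) = ?Q" if "h \<in> positions" for h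
    unfolding realisation_measure_def
    using distr_PiM_component[of positions "\<lambda>_. ?Q" h] that by (simp add: prob_space_measure_pmf)
  have "indep_vars (\<lambda>_. ?Q) (\<lambda>h \<omega>. \<omega> h) positions"
  proof (subst indep_vars_iff_distr_eq_PiM'[OF ne coordinate_measurable])
    have "distr \<P> (\<Pi>\<^sub>M h\<in>positions. ?Q) (\<lambda>\<omega>. \<lambda>h\<in>positions. \<omega> h) = distr \<P> \<P> (\<lambda>\<omega>. \<omega>)"
      unfolding realisation_measure_def by (intro distr_cong) (auto simp: space_PiM)
    also have "\<dots> = (\<Pi>\<^sub>M h\<in>positions. ?Q)"
      by (subst distr_id) (simp add: realisation_measure_def)
    also have "\<dots> = (\<Pi>\<^sub>M h\<in>positions. distr \<P> ?Q (\<lambda>\<omega>. \<omega> h))"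
      by (intro PiM_cong) (simp_all only: Q)
    finally show "distr \<P> (\<Pi>\<^sub>M h\<in>positions. ?Q) (\<lambda>\<omega>. \<lambda>h\<in>positions. \<omega> h)
      = (\<Pi>\<^sub>M h\<in>positions. distr \<P> ?Q (\<lambda>\<omega>. \<omega> h))" .
  qed
  then have "indep_sets (\<lambda>h. {(\<lambda>\<omega>. \<omega> h) -` A \<inter> space \<P> |A. A \<in> sets ?Q}) positions"
    unfolding indep_vars_def2 by blast
  then show ?thesis
    by (rule indep_sets_mono_sets) (auto simp: coordinate_events_def vimage_def Int_def conj_commute)
qed

lemma indep_events_of:
  assumes "disjoint_family_on H J" "\<And>j. j \<in> J \<Longrightarrow> H j \<subseteq> positions"
  shows "indep_sets (\<lambda>j. events_of (H j)) J"
  unfolding events_of_def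
proof (rule indep_sets_collect_sigma[OF _ _ assms(1)])
  show "indep_sets coordinate_events (\<Union>j\<in>J. H j)"
    using assms(2) by (intro indep_sets_mono_index[OF _ indep_coordinate_events]) blast
  show "Int_stable (coordinate_events h)" for h
  proof (rule Int_stableI)
    fix x y assume "x \<in> coordinate_events h" "y \<in> coordinate_events h"
    then obtain A B where "x = {\<omega> \<in> space \<P>. \<omega> h \<in> A}" "y = {\<omega> \<in> space \<P>. \<omega> h \<in> B}"
      by (auto simp: coordinate_events_def)
    then have "x \<inter> y = {\<omega> \<in> space \<P>. \<omega> h \<in> A \<inter> B}" by auto
    then show "x \<inter> y \<in> coordinate_events h" unfolding coordinate_events_def by blast
  qed
qed

text \<open>Since the support is finite, every property of finitely many clipped choices is an event.\<close>

lemma finitely_determined_event: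
  assumes H: "finite H"
    and \<Phi>: "\<And>\<omega> \<omega>'. proper \<omega> \<Longrightarrow> proper \<omega>' \<Longrightarrow> (\<And>h. h \<in> H \<Longrightarrow> \<omega> h = \<omega>' h) \<Longrightarrow> \<Phi> \<omega> = \<Phi> \<omega>'"
  shows "{\<omega> \<in> space \<P>. \<Phi> (clip \<omega>)} \<in> events_of H"
proof -
  interpret E: sigma_algebra "space \<P>" "events_of H" by (rule sigma_algebra_events_of)
  define W where "W = (\<lambda>\<omega>. restrict (clip \<omega>) H) ` {\<omega> \<in> space \<P>. \<Phi> (clip \<omega>)}"
  have "W \<subseteq> H \<rightarrow>\<^sub>E S" by (auto simp: W_def clip_def clip_choice_in)
  then have finW: "finite W" using finite_PiE[OF H, of "\<lambda>_. S"] finite_S finite_subset by blast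
  have "{\<omega> \<in> space \<P>. clip \<omega> h = c} \<in> events_of H" if "h \<in> H" for h c
  proof -
    have "{\<omega> \<in> space \<P>. clip \<omega> h = c} = {\<omega> \<in> space \<P>. \<omega> h \<in> {d. clip_choice d = c}}"
      by (simp add: clip_def)
    also have "\<dots> \<in> coordinate_events h" unfolding coordinate_events_def by blast
    finally show ?thesis unfolding events_of_def using that by blast
  qed
  then have "{\<omega> \<in> space \<P>. \<forall>h\<in>H. clip \<omega> h = t h} \<in> events_of H" for t
    using H by (intro E.sets_Collect_countable_All') (auto simp: countable_finite)
  then have "{\<omega> \<in> space \<P>. \<exists>t\<in>W. \<forall>h\<in>H. clip \<omega> h = t h} \<in> events_of H"
    using finW by (intro E.sets_Collect_countable_Ex') (auto simp: countable_finite)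
  also have "{\<omega> \<in> space \<P>. \<exists>t\<in>W. \<forall>h\<in>H. clip \<omega> h = t h} = {\<omega> \<in> space \<P>. \<Phi> (clip \<omega>)}"
  proof (intro Collect_cong conj_cong refl iffI)
    fix \<omega> assume "\<exists>t\<in>W. \<forall>h\<in>H. clip \<omega> h = t h"
    then obtain \<omega>' where "\<Phi> (clip \<omega>')" "\<forall>h\<in>H. clip \<omega> h = clip \<omega>' h" by (auto simp: W_def)
    then show "\<Phi> (clip \<omega>)" using \<Phi>[OF proper_clip proper_clip, of \<omega> \<omega>'] by simp
  next
    fix \<omega> assume "\<omega> \<in> space \<P>" "\<Phi> (clip \<omega>)"
    then show "\<exists>t\<in>W. \<forall>h\<in>H. clip \<omega> h = t h"
      by (intro bexI[of _ "restrict (clip \<omega>) H"]) (auto simp: W_def)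
  qed
  finally show ?thesis .
qed

lemma max_psum_event:
  assumes "v \<in> {1..V}"
  shows "{\<omega> \<in> space \<P>. Q (max_psum s (clip \<omega>) i v k)} \<in> events_of (levels {i..<i + k})"
proof (rule finitely_determined_event)
  fix \<omega> \<omega>' assume "proper \<omega>'" "\<And>h. h \<in> levels {i..<i + k} \<Longrightarrow> \<omega> h = \<omega>' h"
  then show "Q (max_psum s \<omega> i v k) = Q (max_psum s \<omega>' i v k)"
    using max_psum_cong[of \<omega>' k \<omega> i i v s] assms by auto
qed simp

text \<open>Events that read the realisation only from level \<open>i\<close> on have the same probability for all \<open>i\<close>,
  because the shift of levels preserves the measure.\<close>

lemma stationary:
  fixes \<Phi> :: "'l realisation \<Rightarrow> nat \<Rightarrow> bool"
  assumes inv: "\<And>\<omega> \<omega>' i i'. proper \<omega> \<Longrightarrow> proper \<omega>' \<Longrightarrow>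
      (\<And>l u. u \<in> {1..V} \<Longrightarrow> \<omega> (i + l, u) = \<omega>' (i' + l, u)) \<Longrightarrow> \<Phi> \<omega> i = \<Phi> \<omega>' i'"
    and meas: "{\<omega> \<in> space \<P>. \<Phi> (clip \<omega>) 1} \<in> events" and i: "1 \<le> i"
  shows "prob {\<omega> \<in> space \<P>. \<Phi> (clip \<omega>) i} = prob {\<omega> \<in> space \<P>. \<Phi> (clip \<omega>) 1}"
proof -
  let ?Q = "measure_pmf (choice_pmf p M V)"
  define \<tau> where "\<tau> = (\<lambda>h::nat \<times> nat. (fst h + (i - 1), snd h))"
  define T where "T = (\<lambda>\<omega>::'l realisation. \<lambda>h\<in>positions. \<omega> (\<tau> h))"
  have \<tau>: "\<tau> h \<in> positions" if "h \<in> positions" for h using that by (auto simp: \<tau>_def)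
  have "T \<in> \<P> \<rightarrow>\<^sub>M (\<Pi>\<^sub>M h\<in>positions. ?Q)"
    unfolding T_def using \<tau> coordinate_measurable by (intro measurable_restrict) auto
  then have T: "T \<in> \<P> \<rightarrow>\<^sub>M \<P>" by (simp add: realisation_measure_def)
  have distr: "distr \<P> \<P> T = \<P>"
    unfolding realisation_measure_def T_def
    using distr_PiM_reindex[of positions "\<lambda>_. ?Q" \<tau> positions] \<tau>
    by (simp add: prob_space_measure_pmf inj_on_def \<tau>_def)
  have "T -` {\<omega> \<in> space \<P>. \<Phi> (clip \<omega>) 1} \<inter> space \<P> = {\<omega> \<in> space \<P>. \<Phi> (clip \<omega>) i}"
  proof -
    have "\<Phi> (clip (T \<omega>)) 1 = \<Phi> (clip \<omega>) i" for \<omega>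
      using i by (intro inv proper_clip) (simp add: clip_def T_def \<tau>_def add.commute)
    then show ?thesis using measurable_space[OF T] by auto
  qed
  then show ?thesis
    using measure_distr[OF T meas] distr by simp
qed

section \<open>Unbounded growth is a zero-one event\<close>

text \<open>Asking for every factor \<open>C\<close>, and not just for 1, makes the property insensitive to prepending
  a letter; its negation bounds all weights by \<open>C * exp (\<epsilon> * k)\<close> for one \<open>C\<close>.\<close>

definition unbounded_growth :: "real \<Rightarrow> real \<Rightarrow> nat \<Rightarrow> nat \<Rightarrow> 'l realisation \<Rightarrow> bool" where
  "unbounded_growth s \<epsilon> v i \<omega> \<longleftrightarrow>
     (\<forall>C::nat. \<exists>k\<in>{1..}. real C * exp (\<epsilon> * real k) \<le> max_psum s \<omega> i v k)"

lemma unbounded_growth_event: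
  assumes v: "v \<in> {1..V}"
  shows "{\<omega> \<in> space \<P>. unbounded_growth s \<epsilon> v i (clip \<omega>)} \<in> events_of (levels {i..})"
proof -
  interpret E: sigma_algebra "space \<P>" "events_of (levels {i..})" by (rule sigma_algebra_events_of)
  have "events_of (levels {i..<i + k}) \<subseteq> events_of (levels {i..})" for k
    by (rule events_of_mono) auto
  then show ?thesis
    unfolding unbounded_growth_def using max_psum_event[OF v]
    by (intro E.sets_Collect_countable_All E.sets_Collect_countable_Ex') blast+
qed

lemma unbounded_growth_shift:
  assumes \<omega>: "proper \<omega>" "proper \<omega>'" and v: "v \<in> {1..V}"
    and eq: "\<And>l u. u \<in> {1..V} \<Longrightarrow> \<omega> (i + l, u) = \<omega>' (i' + l, u)"
  shows "unbounded_growth s \<epsilon> v i \<omega> = unbounded_growth s \<epsilon> v i' \<omega>'"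
proof -
  have "max_psum s \<omega> i v k = max_psum s \<omega>' i' v k" for k
    by (rule max_psum_cong[OF \<omega>(2) eq v])
  then show ?thesis by (simp add: unbounded_growth_def)
qed

lemma unbounded_growth_step:
  assumes \<omega>: "proper \<omega>" and s: "0 < s" and \<epsilon>: "0 < \<epsilon>"
    and nxt: "unbounded_growth s \<epsilon> (next_type \<omega> i v 1) (Suc i) \<omega>"
  shows "unbounded_growth s \<epsilon> v i \<omega>"
  unfolding unbounded_growth_def
proof
  fix C :: nat
  define B where "B = nat \<lceil>real C * exp \<epsilon> / a powr s\<rceil>"
  have as: "0 < a powr s" using ab by simp
  obtain k where k: "1 \<le> k" "real B * exp (\<epsilon> * real k) \<le> max_psum s \<omega> (Suc i) (next_type \<omega> i v 1) k"
    using nxt unfolding unbounded_growth_def by (meson atLeast_iff)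
  have "real C * exp \<epsilon> / a powr s \<le> real B" unfolding B_def by linarith
  then have "real C * exp \<epsilon> \<le> a powr s * real B" using as by (simp add: field_simps)
  then have "real C * exp \<epsilon> * exp (\<epsilon> * real k) \<le> a powr s * real B * exp (\<epsilon> * real k)"
    by (rule mult_right_mono) simp
  also have "\<dots> \<le> a powr s * max_psum s \<omega> (Suc i) (next_type \<omega> i v 1) k"
    using k(2) as by (simp add: mult.assoc)
  also have "\<dots> \<le> max_psum s \<omega> i v (Suc k)" using max_psum_Suc[OF \<omega>] s by simp
  finally have "real C * exp (\<epsilon> * real (Suc k)) \<le> max_psum s \<omega> i v (Suc k)"
    by (simp add: distrib_left exp_add mult_ac)
  then show "\<exists>k\<in>{1..}. real C * exp (\<epsilon> * real k) \<le> max_psum s \<omega> i v k"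
    by (intro bexI[of _ "Suc k"]) auto
qed

text \<open>Unbounded growth from every type of level \<open>i\<close>.\<close>

definition all_unbounded :: "real \<Rightarrow> real \<Rightarrow> nat \<Rightarrow> 'l realisation set" where
  "all_unbounded s \<epsilon> i = {\<omega> \<in> space \<P>. \<forall>v\<in>{1..V}. unbounded_growth s \<epsilon> v i (clip \<omega>)}"

lemma all_unbounded_event: "all_unbounded s \<epsilon> i \<in> events_of (levels {i..})"
proof -
  interpret E: sigma_algebra "space \<P>" "events_of (levels {i..})" by (rule sigma_algebra_events_of)
  show ?thesis
    unfolding all_unbounded_def using unbounded_growth_event
    by (intro E.sets_Collect_countable_All') auto
qed

lemma levels_subset_positions: "1 \<le> i \<Longrightarrow> levels {i..} \<subseteq> positions"
  by auto

lemma all_unbounded_sets: "1 \<le> i \<Longrightarrow> all_unbounded s \<epsilon> i \<in> events"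
  using all_unbounded_event events_of_subset[OF levels_subset_positions] by blast

lemma prob_all_unbounded: "1 \<le> i \<Longrightarrow> prob (all_unbounded s \<epsilon> i) = prob (all_unbounded s \<epsilon> 1)"
  unfolding all_unbounded_def
proof (rule stationary)
  show "{\<omega> \<in> space \<P>. \<forall>v\<in>{1..V}. unbounded_growth s \<epsilon> v 1 (clip \<omega>)} \<in> events"
    using all_unbounded_sets[of 1 s \<epsilon>] by (simp add: all_unbounded_def)
  fix \<omega> \<omega>' :: "'l realisation" and i i'
  assume "proper \<omega>" "proper \<omega>'" "\<And>l u. u \<in> {1..V} \<Longrightarrow> \<omega> (i + l, u) = \<omega>' (i' + l, u)"
  then show "(\<forall>v\<in>{1..V}. unbounded_growth s \<epsilon> v i \<omega>) = (\<forall>v\<in>{1..V}. unbounded_growth s \<epsilon> v i' \<omega>')"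
    using unbounded_growth_shift by blast
qed

lemma next_type_clip: "v \<in> {1..V} \<Longrightarrow> next_type (clip \<omega>) i v 1 \<in> {1..V}"
  using types[of "clip \<omega> (i, v)" 1] M_pos[of "clip \<omega> (i, v)"] proper_clip[of \<omega>]
  by (simp add: proper_def next_type_def)

lemma all_unbounded_Suc:
  assumes "0 < s" "0 < \<epsilon>"
  shows "all_unbounded s \<epsilon> (Suc i) \<subseteq> all_unbounded s \<epsilon> i"
  using unbounded_growth_step[OF proper_clip assms] next_type_clip by (auto simp: all_unbounded_def)

text \<open>The events decrease in the level, and by stationarity all have the same probability. Their
  intersection has this probability as well, and it is a tail event.\<close>

lemma all_unbounded_0_1:
  assumes "0 < s" "0 < \<epsilon>"
  shows "prob (all_unbounded s \<epsilon> 1) = 0 \<or> prob (all_unbounded s \<epsilon> 1) = 1"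
proof -
  let ?D = "\<lambda>n. all_unbounded s \<epsilon> (Suc n)"
  let ?F = "\<lambda>n. events_of (levels {Suc n})"
  have dec: "decseq ?D" using all_unbounded_Suc[OF assms] by (intro decseq_SucI)
  have "indep_sets ?F UNIV"
    by (rule indep_events_of) (auto simp: disjoint_family_on_def)
  moreover have "(\<Inter>n. ?D n) \<in> tail_events ?F"
    unfolding tail_events_def
  proof
    fix n
    interpret T: sigma_algebra "space \<P>" "sigma_sets (space \<P>) (\<Union> (?F ` {n..}))"
    proof (rule sigma_algebra_sigma_sets)
      show "\<Union> (?F ` {n..}) \<subseteq> Pow (space \<P>)"
        unfolding events_of_def
        by (auto dest!: sigma_sets_into_sp[rotated] simp: coordinate_events_def)
    qed
    have "events_of (levels {Suc k..}) \<subseteq> sigma_sets (space \<P>) (\<Union> (?F ` {n..}))" if "n \<le> k" for k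
    proof -
      have "(\<Union>h\<in>levels {Suc k..}. coordinate_events h) \<subseteq> \<Union> (?F ` {n..})"
      proof
        fix X assume "X \<in> (\<Union>h\<in>levels {Suc k..}. coordinate_events h)"
        then obtain j v where *: "Suc k \<le> j" "v \<in> {1..V}" "X \<in> coordinate_events (j, v)" by auto
        have "X \<in> ?F (j - 1)" using * unfolding events_of_def
          by (intro sigma_sets.Basic UN_I[of "(j, v)"]) auto
        then show "X \<in> \<Union> (?F ` {n..})" using * that by (intro UN_I[of "j - 1"]) auto
      qed
      then show ?thesis unfolding events_of_def[of "levels {Suc k..}"]
        by (rule sigma_sets_mono[OF subset_trans]) (auto intro: sigma_sets.Basic)
    qed
    then have "?D k \<in> sigma_sets (space \<P>) (\<Union> (?F ` {n..}))" if "n \<le> k" for k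
      using all_unbounded_event that by blast
    then have "(\<Inter>k\<in>{n..}. ?D k) \<in> sigma_sets (space \<P>) (\<Union> (?F ` {n..}))"
      by (intro T.countable_INT') auto
    moreover have "(\<Inter>k\<in>{n..}. ?D k) = (\<Inter>k. ?D k)"
    proof
      show "(\<Inter>k\<in>{n..}. ?D k) \<subseteq> (\<Inter>k. ?D k)"
      proof (intro INT_greatest)
        fix k
        have "(\<Inter>k\<in>{n..}. ?D k) \<subseteq> ?D (max k n)" by (rule INT_lower) simp
        also have "\<dots> \<subseteq> ?D k" by (rule decseqD[OF dec]) simp
        finally show "(\<Inter>k\<in>{n..}. ?D k) \<subseteq> ?D k" .
      qed
    qed auto
    ultimately show "(\<Inter>k. ?D k) \<in> sigma_sets (space \<P>) (\<Union> (?F ` {n..}))" by simp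
  qed
  ultimately have "prob (\<Inter>n. ?D n) = 0 \<or> prob (\<Inter>n. ?D n) = 1"
    using kolmogorov_0_1_law[of ?F] sigma_algebra_events_of by blast
  moreover have "(\<lambda>n. prob (?D n)) \<longlonglongrightarrow> prob (\<Inter>n. ?D n)"
    by (rule finite_Lim_measure_decseq[OF _ dec]) (use all_unbounded_sets in auto)
  then have "(\<lambda>n::nat. prob (all_unbounded s \<epsilon> 1)) \<longlonglongrightarrow> prob (\<Inter>n. ?D n)"
    by (subst (asm) prob_all_unbounded) simp_all
  then have "prob (all_unbounded s \<epsilon> 1) = prob (\<Inter>n. ?D n)"
    by (simp add: LIMSEQ_const_iff)
  ultimately show ?thesis by simp
qed

text \<open>With positive probability the first letter leads from every type of level 1 to type 1. Hence
  growth from type 1 alone already has a positive chance to cause growth from all types.\<close>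

lemma prob_unbounded_growth_zero:
  assumes s: "0 < s" and \<epsilon>: "0 < \<epsilon>" and zero: "prob (all_unbounded s \<epsilon> 1) = 0"
  shows "prob {\<omega> \<in> space \<P>. unbounded_growth s \<epsilon> 1 1 (clip \<omega>)} = 0"
proof -
  let ?A = "\<lambda>i. {\<omega> \<in> space \<P>. unbounded_growth s \<epsilon> 1 i (clip \<omega>)}"
  let ?Hv = "\<lambda>v. {\<omega> \<in> space \<P>. \<omega> (1, v) \<in> {c. snd (clip_choice c) 1 = 1}}"
  let ?H = "\<Inter>v\<in>{1..V}. ?Hv v"
  let ?Q = "choice_pmf p M V"
  have 1: "1 \<in> {1..V}" using V_pos by simp
  have A: "?A i \<in> events_of (levels {i..})" for i by (rule unbounded_growth_event[OF 1])
  have Hv: "?Hv v \<in> coordinate_events (1, v)" for v unfolding coordinate_events_def by blast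
  have "?Hv v \<in> events_of (levels {1})" if "v \<in> {1..V}" for v
    unfolding events_of_def using Hv[of v] that by (intro sigma_sets.Basic UN_I[of "(1, v)"]) auto
  then have H: "?H \<in> events_of (levels {1})"
    using V_pos sigma_algebra.countable_INT'[OF sigma_algebra_events_of, of "{1..V}"]
    by (auto simp: image_subset_iff)
  have "indep_sets (\<lambda>b. events_of (if b then levels {1} else levels {2..})) UNIV"
    by (rule indep_events_of) (auto simp: disjoint_family_on_def split: if_splits)
  then have "prob (\<Inter>b\<in>UNIV. if b then ?H else ?A 2) = (\<Prod>b\<in>UNIV. prob (if b then ?H else ?A 2))"
    using H A[of 2] by (intro indep_setsD) auto
  then have indep: "prob (?H \<inter> ?A 2) = prob ?H * prob (?A 2)" by (simp add: UNIV_bool Int_commute)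
  have "?H \<inter> ?A 2 \<subseteq> all_unbounded s \<epsilon> 1"
  proof
    fix \<omega> assume \<omega>: "\<omega> \<in> ?H \<inter> ?A 2"
    have "next_type (clip \<omega>) 1 v 1 = 1" if "v \<in> {1..V}" for v
      using \<omega> that by (auto simp: next_type_def clip_def)
    then show "\<omega> \<in> all_unbounded s \<epsilon> 1"
      using \<omega> unbounded_growth_step[OF proper_clip s \<epsilon>, of \<omega> 1] by (auto simp: all_unbounded_def numeral_2_eq_2)
  qed
  then have "prob (?H \<inter> ?A 2) \<le> 0"
    unfolding zero[symmetric] using all_unbounded_sets[of 1 s \<epsilon>] by (intro finite_measure_mono) simp_all
  then have prod0: "prob ?H * prob (?A 2) \<le> 0" using indep by simp
  have "prob ?H = (\<Prod>v\<in>{1..V}. prob (?Hv v))"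
  proof -
    have "prob (\<Inter>h\<in>levels {1}. ?Hv (snd h)) = (\<Prod>h\<in>levels {1}. prob (?Hv (snd h)))"
      using Hv V_pos by (intro indep_setsD[OF indep_coordinate_events]) auto
    moreover have "levels {1} = Pair 1 ` {1..V}" by auto
    ultimately show ?thesis by (simp add: prod.reindex inj_on_def image_image del: One_nat_def)
  qed
  moreover
  have "0 < prob (?Hv v)" if v: "v \<in> {1..V}" for v
  proof -
    let ?B = "{c. snd (clip_choice c) 1 = 1}"
    obtain i where i: "i \<in> set_pmf p" using set_pmf_not_empty[of p] by blast
    define J where "J = (\<lambda>m. if m \<in> {1..M i} then 1 else undefined :: nat)"
    have "J \<in> set_pmf (Pi_pmf {1..M i} undefined (\<lambda>_. pmf_of_set {1..V}))"
      using V_pos by (simp add: set_Pi_pmf PiE_dflt_def J_def set_pmf_of_set)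
    then have c: "(i, J) \<in> set_pmf ?Q" using i by (auto simp: choice_pmf_def)
    then have "1 \<le> M i" using M_pos[of "(i, J)"] S_eq by simp
    moreover have "clip_choice (i, J) = (i, J)"
      using c unfolding clip_choice_def S_eq[symmetric] by simp
    ultimately have "(i, J) \<in> ?B" by (simp add: J_def)
    then have "0 < measure_pmf.prob ?Q ?B"
      using c by (meson measure_pmf_posI)
    also have "measure_pmf.prob ?Q ?B = measure (distr \<P> (measure_pmf ?Q) (\<lambda>\<omega>. \<omega> (1, v))) ?B"
      unfolding realisation_measure_def
      using v by (subst distr_PiM_component) (auto simp: prob_space_measure_pmf)
    also have "\<dots> = prob (?Hv v)"
      using v by (subst measure_distr[OF coordinate_measurable]) (auto intro!: arg_cong[of _ _ prob])
    finally show ?thesis .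
  qed
  then have "0 < (\<Prod>v\<in>{1..V}. prob (?Hv v))" by (rule prod_pos)
  ultimately have "0 < prob ?H" by (simp only:)
  then have "prob (?A 2) \<le> 0" using prod0 by (auto simp: mult_le_0_iff)
  then have "prob (?A 2) = 0" by (intro order_antisym measure_nonneg)
  moreover have "prob (?A 2) = prob (?A 1)"
  proof (rule stationary)
    show "?A 1 \<in> events"
      using A[of 1] events_of_subset[OF levels_subset_positions] by blast
  qed (use unbounded_growth_shift 1 in blast, simp)
  ultimately show ?thesis by simp
qed

end

section \<open>The dichotomy\<close>

context random_family
begin

lemma good_level_event:
  "{\<omega> \<in> space \<P>. good_level s \<epsilon> K i (clip \<omega>)} \<in> events_of (levels {i..<i + K})"
proof -
  interpret E: sigma_algebra "space \<P>" "events_of (levels {i..<i + K})" by (rule sigma_algebra_events_of)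
  have "{\<omega> \<in> space \<P>. exp (\<epsilon> * real k) \<le> max_psum s (clip \<omega>) i v k} \<in> events_of (levels {i..<i + K})"
    if "v \<in> {1..V}" "k \<in> {1..K}" for v k
    using max_psum_event[OF that(1), of "\<lambda>x. exp (\<epsilon> * real k) \<le> x" s i k]
      events_of_mono[of "levels {i..<i + k}" "levels {i..<i + K}"] that(2) by fastforce
  then show ?thesis
    unfolding good_level_def
    by (intro E.sets_Collect_countable_All' E.sets_Collect_countable_Ex') auto
qed

lemma good_level_sets: "1 \<le> i \<Longrightarrow> {\<omega> \<in> space \<P>. good_level s \<epsilon> K i (clip \<omega>)} \<in> events"
  using good_level_event events_of_subset[of "levels {i..<i + K}"] by fastforce

lemma prob_good_level:
  assumes "1 \<le> i"
  shows "prob {\<omega> \<in> space \<P>. good_level s \<epsilon> K i (clip \<omega>)} = prob {\<omega> \<in> space \<P>. good_level s \<epsilon> K 1 (clip \<omega>)}"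
proof (rule stationary[where \<Phi> = "\<lambda>\<omega> i. good_level s \<epsilon> K i \<omega>", OF _ good_level_sets[OF order_refl] assms])
  fix \<omega> \<omega>' :: "'l realisation" and i i'
  assume *: "proper \<omega>" "proper \<omega>'" "\<And>l u. u \<in> {1..V} \<Longrightarrow> \<omega> (i + l, u) = \<omega>' (i' + l, u)"
  have "max_psum s \<omega> i v k = max_psum s \<omega>' i' v k" if "v \<in> {1..V}" for v k
    by (rule max_psum_cong[OF *(2,3) that])
  then show "good_level s \<epsilon> K i \<omega> = good_level s \<epsilon> K i' \<omega>'" by (simp add: good_level_def)
qed

lemma good_level_likely:
  assumes "prob (all_unbounded s \<epsilon> 1) = 1" "0 < \<eta>"
  shows "\<exists>K. 1 - \<eta> < prob {\<omega> \<in> space \<P>. good_level s \<epsilon> K 1 (clip \<omega>)}"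
proof -
  let ?G = "\<lambda>K. {\<omega> \<in> space \<P>. good_level s \<epsilon> K 1 (clip \<omega>)}"
  have inc: "incseq ?G"
    by (rule incseq_SucI) (fastforce simp: good_level_def)
  have G: "range ?G \<subseteq> events" using good_level_sets by blast
  have "all_unbounded s \<epsilon> 1 \<subseteq> (\<Union>K. ?G K)"
  proof
    fix \<omega> assume \<omega>: "\<omega> \<in> all_unbounded s \<epsilon> 1"
    have "\<exists>k\<ge>1. exp (\<epsilon> * real k) \<le> max_psum s (clip \<omega>) 1 v k" if "v \<in> {1..V}" for v
    proof -
      have "unbounded_growth s \<epsilon> v 1 (clip \<omega>)" using \<omega> that by (auto simp: all_unbounded_def)
      from this[unfolded unbounded_growth_def, THEN spec, of 1] show ?thesis by auto
    qed
    then obtain k where k: "\<And>v. v \<in> {1..V} \<Longrightarrow> 1 \<le> k v \<and> exp (\<epsilon> * real (k v)) \<le> max_psum s (clip \<omega>) 1 v (k v)"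
      by metis
    have "k v \<le> Max (k ` {1..V})" if "v \<in> {1..V}" for v
      using that by (intro Max_ge) auto
    then have "good_level s \<epsilon> (Max (k ` {1..V})) 1 (clip \<omega>)"
      unfolding good_level_def using k by (intro ballI) (metis atLeastAtMost_iff)
    then show "\<omega> \<in> (\<Union>K. ?G K)" using \<omega> by (auto simp: all_unbounded_def)
  qed
  then have "prob (all_unbounded s \<epsilon> 1) \<le> prob (\<Union>K. ?G K)"
    using G by (intro finite_measure_mono sets.countable_UN) auto
  then have "prob (\<Union>K. ?G K) = 1" using assms(1) prob_le_1[of "\<Union>K. ?G K"] by linarith
  then have "(\<lambda>K. prob (?G K)) \<longlonglongrightarrow> 1" using finite_Lim_measure_incseq[OF G inc] by simp
  then have "\<forall>\<^sub>F K in sequentially. 1 - \<eta> < prob (?G K)"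
    by (rule order_tendstoD) (use assms(2) in simp)
  then show ?thesis by (auto simp: eventually_sequentially)
qed

lemma min_log_psum_indep:
  assumes n: "1 \<le> n"
  shows "indep_vars (\<lambda>_. borel) (\<lambda>j \<omega>. min_log_psum s \<epsilon> n (1 + j * n) (clip \<omega>)) UNIV"
proof -
  let ?H = "\<lambda>j. levels {1 + j * n..<1 + j * n + n}"
  have E: "{\<omega> \<in> space \<P>. min_log_psum s \<epsilon> n (1 + j * n) (clip \<omega>) \<in> A} \<in> events_of (?H j)" for j A
  proof (rule finitely_determined_event)
    fix \<omega> \<omega>' :: "'l realisation" assume *: "proper \<omega>'" "\<And>h. h \<in> ?H j \<Longrightarrow> \<omega> h = \<omega>' h"
    have "max_psum s \<omega> (1 + j * n) v n = max_psum s \<omega>' (1 + j * n) v n" if "v \<in> {1..V}" for v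
      by (rule max_psum_cong[OF *(1) _ that]) (use *(2) in auto)
    then have "min_log_psum s \<epsilon> n (1 + j * n) \<omega> = min_log_psum s \<epsilon> n (1 + j * n) \<omega>'"
      unfolding min_log_psum_def by (intro arg_cong[of _ _ Min] image_cong) auto
    then show "(min_log_psum s \<epsilon> n (1 + j * n) \<omega> \<in> A) = (min_log_psum s \<epsilon> n (1 + j * n) \<omega>' \<in> A)" by simp
  qed simp
  have pos: "?H j \<subseteq> positions" for j by auto
  have "?H i \<inter> ?H j = {}" if "i < j" for i j
  proof -
    have "Suc i * n \<le> j * n" using that by (intro mult_le_mono1) simp
    then show ?thesis by auto
  qed
  then have "disjoint_family_on ?H UNIV"
    unfolding disjoint_family_on_def by (metis Int_commute nat_neq_iff)
  then have "indep_sets (\<lambda>j. events_of (?H j)) UNIV" by (rule indep_events_of) (rule pos)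
  then have "indep_sets (\<lambda>j. {(\<lambda>\<omega>. min_log_psum s \<epsilon> n (1 + j * n) (clip \<omega>)) -` A \<inter> space \<P> |A. A \<in> sets borel}) UNIV"
    by (rule indep_sets_mono_sets) (use E in \<open>auto simp: vimage_def Int_def conj_commute\<close>)
  moreover have "random_variable borel (\<lambda>\<omega>. min_log_psum s \<epsilon> n (1 + j * n) (clip \<omega>))" for j
  proof (rule measurableI)
    fix A
    have "{\<omega> \<in> space \<P>. min_log_psum s \<epsilon> n (1 + j * n) (clip \<omega>) \<in> A} \<in> events"
      using E[of j A] events_of_subset[OF pos] by blast
    then show "(\<lambda>\<omega>. min_log_psum s \<epsilon> n (1 + j * n) (clip \<omega>)) -` A \<inter> space \<P> \<in> events"
      by (simp add: vimage_def Int_def conj_commute)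
  qed simp
  ultimately show ?thesis unfolding indep_vars_def2 by simp
qed

text \<open>For large \<open>K\<close> almost all levels are good, so for large \<open>n\<close> the expected gain of a block of length
  \<open>n\<close> is at least 1. The gains of consecutive blocks are independent, and the strong law
  applies.\<close>

lemma hausdorff_dim_ge_AE:
  assumes s: "0 < s" and \<epsilon>: "0 < \<epsilon>" and one: "prob (all_unbounded s \<epsilon> 1) = 1"
  shows "AE \<omega> in \<P>. ereal s \<le> hausdorff_dim (attractor (clip \<omega>))"
proof -
  define \<kappa> where "\<kappa> = \<epsilon> - s * ln a"
  have sln: "s * ln a < 0" using ab s by (simp add: mult_pos_neg)
  then have \<kappa>: "0 < \<kappa>" using \<epsilon> by (simp add: \<kappa>_def)
  \<comment> \<open>a bad level costs \<open>\<kappa>\<close>, so this frequency uses up half of the gain \<open>\<epsilon>\<close> per level\<close>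
  obtain K where K: "1 - \<epsilon> / (2 * \<kappa>) < prob {\<omega> \<in> space \<P>. good_level s \<epsilon> K 1 (clip \<omega>)}"
    using good_level_likely[OF one, of "\<epsilon> / (2 * \<kappa>)"] \<epsilon> \<kappa> by auto
  define n where "n = Suc (nat \<lceil>2 * (\<kappa> * real K + 1) / \<epsilon>\<rceil>)"
  have "2 * (\<kappa> * real K + 1) / \<epsilon> \<le> real n" unfolding n_def by linarith
  then have n: "1 \<le> n" "\<kappa> * real K + 1 \<le> \<epsilon> * real n / 2"
    using \<epsilon> by (auto simp: n_def field_simps)
  let ?X = "\<lambda>j \<omega>. min_log_psum s \<epsilon> n (1 + j * n) (clip \<omega>)"
  let ?B = "\<lambda>i. {\<omega> \<in> space \<P>. \<not> good_level s \<epsilon> K i (clip \<omega>)}"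
  have B: "?B i \<in> events" "prob (?B i) \<le> \<epsilon> / (2 * \<kappa>)" if "1 \<le> i" for i
  proof -
    have G: "{\<omega> \<in> space \<P>. good_level s \<epsilon> K i (clip \<omega>)} \<in> events" by (rule good_level_sets[OF that])
    have eq: "?B i = space \<P> - {\<omega> \<in> space \<P>. good_level s \<epsilon> K i (clip \<omega>)}" by auto
    show "?B i \<in> events" unfolding eq using G by blast
    have "prob (?B i) = 1 - prob {\<omega> \<in> space \<P>. good_level s \<epsilon> K i (clip \<omega>)}"
      unfolding eq by (rule prob_compl[OF G])
    then show "prob (?B i) \<le> \<epsilon> / (2 * \<kappa>)" using K prob_good_level[OF that, of s \<epsilon> K] by linarith
  qed
  have bounds: "?X j \<omega> \<in> {s * ln a * real n..\<epsilon> * real n}" for j \<omega>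
    by (rule min_log_psum_bounds[OF proper_clip s \<epsilon>])
  have indep: "indep_vars (\<lambda>_. borel) ?X UNIV" by (rule min_log_psum_indep[OF n(1)])
  have E: "1 \<le> expectation (?X j)" for j
  proof -
    define I where "I = {1 + j * n..<1 + j * n + n}"
    have I: "finite I" "card I = n" by (simp_all add: I_def)
    have I_ge: "1 \<le> i" if "i \<in> I" for i using that by (simp add: I_def)
    let ?Y = "\<lambda>\<omega>. \<epsilon> * real n - \<kappa> * (\<Sum>i\<in>I. indicator (?B i) \<omega>) - \<kappa> * real K"
    have int: "integrable \<P> (indicator (?B i) :: _ \<Rightarrow> real)" if "i \<in> I" for i
      using B(1)[OF I_ge[OF that]] by (intro integrable_real_indicator) (auto simp: emeasure_eq_measure)
    have intX: "integrable \<P> (?X j)"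
    proof (rule integrable_const_bound[of _ "max \<bar>s * ln a * real n\<bar> \<bar>\<epsilon> * real n\<bar>"])
      show "AE \<omega> in \<P>. norm (?X j \<omega>) \<le> max \<bar>s * ln a * real n\<bar> \<bar>\<epsilon> * real n\<bar>"
      proof (intro AE_I2)
        fix \<omega>
        show "norm (?X j \<omega>) \<le> max \<bar>s * ln a * real n\<bar> \<bar>\<epsilon> * real n\<bar>"
          using bounds[of j \<omega>] by auto
      qed
      show "random_variable borel (?X j)" using indep by (simp add: indep_vars_def2)
    qed
    have "1 \<le> \<epsilon> * real n - \<kappa> * (real n * (\<epsilon> / (2 * \<kappa>))) - \<kappa> * real K"
      using n \<kappa> by (simp add: field_simps)
    also have "\<dots> \<le> \<epsilon> * real n - \<kappa> * (\<Sum>i\<in>I. prob (?B i)) - \<kappa> * real K"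
    proof -
      have "(\<Sum>i\<in>I. prob (?B i)) \<le> (\<Sum>i\<in>I. \<epsilon> / (2 * \<kappa>))" by (intro sum_mono B(2) I_ge)
      then have "(\<Sum>i\<in>I. prob (?B i)) \<le> real n * (\<epsilon> / (2 * \<kappa>))" by (simp add: I)
      then show ?thesis using \<kappa> by (intro diff_right_mono diff_left_mono mult_left_mono) auto
    qed
    also have "\<dots> = expectation ?Y"
    proof -
      have sum: "integrable \<P> (\<lambda>\<omega>. \<Sum>i\<in>I. indicator (?B i) \<omega> :: real)"
        by (intro Bochner_Integration.integrable_sum int)
      have "expectation ?Y = expectation (\<lambda>\<omega>. \<epsilon> * real n - \<kappa> * (\<Sum>i\<in>I. indicator (?B i) \<omega>)) - \<kappa> * real K"
        using sum by (subst Bochner_Integration.integral_diff) (auto simp: prob_space)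
      also have "\<dots> = \<epsilon> * real n - \<kappa> * expectation (\<lambda>\<omega>. \<Sum>i\<in>I. indicator (?B i) \<omega>) - \<kappa> * real K"
        using sum by (subst Bochner_Integration.integral_diff) (auto simp: prob_space)
      also have "expectation (\<lambda>\<omega>. \<Sum>i\<in>I. indicator (?B i) \<omega>) = (\<Sum>i\<in>I. expectation (indicat_real (?B i)))"
        by (rule Bochner_Integration.integral_sum[OF int])
      also have "\<dots> = (\<Sum>i\<in>I. prob (?B i))"
        by (intro sum.cong refl) (simp add: Int_def conj_commute cong: conj_cong)
      finally show ?thesis by simp
    qed
    also have "\<dots> \<le> expectation (?X j)"
    proof (rule integral_mono)
      show "integrable \<P> ?Y"
        by (intro Bochner_Integration.integrable_diff integrable_const integrable_mult_right
            Bochner_Integration.integrable_sum int)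
      fix \<omega> assume \<omega>: "\<omega> \<in> space \<P>"
      have "(\<Sum>i\<in>I. indicator (?B i) \<omega>) = real (card {i\<in>I. \<not> good_level s \<epsilon> K i (clip \<omega>)})"
        using \<omega> I(1) by (simp add: indicator_def sum.If_cases Int_def)
      then show "?Y \<omega> \<le> ?X j \<omega>"
        using min_log_psum_ge[OF proper_clip s \<epsilon>, of n "1 + j * n" K \<omega>] by (simp add: \<kappa>_def I_def)
    qed (rule intX)
    finally show ?thesis .
  qed
  have "s * ln a * real n < \<epsilon> * real n"
    using sln \<epsilon> n(1) by (intro mult_strict_right_mono) auto
  then have "AE \<omega> in \<P>. \<forall>\<^sub>F J in sequentially. 0 \<le> (\<Sum>j<J. ?X j \<omega>)"
    by (rule sums_eventually_nonneg[OF indep bounds _ zero_less_one E])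
  then show ?thesis
    by (rule AE_mp) (intro AE_I2 impI hausdorff_dim_ge_of_sums[OF proper_clip s n(1)])
qed

lemma upper_box_dim_le_AE:
  assumes s: "0 < s" and \<epsilon>: "0 < \<epsilon>" and zero: "prob (all_unbounded s \<epsilon> 1) = 0"
  shows "AE \<omega> in \<P>. upper_box_dim (attractor (clip \<omega>)) \<le> ereal (s + \<epsilon> / - ln b)"
proof -
  let ?A = "{\<omega> \<in> space \<P>. unbounded_growth s \<epsilon> 1 1 (clip \<omega>)}"
  have "?A \<in> events"
    using unbounded_growth_event[of 1 s \<epsilon> 1] V_pos events_of_subset[OF levels_subset_positions[of 1]] by auto
  moreover have "prob ?A = 0" by (rule prob_unbounded_growth_zero[OF assms])
  ultimately have "AE \<omega> in \<P>. \<omega> \<notin> ?A"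
    by (intro AE_not_in) (auto simp: null_sets_def emeasure_eq_measure)
  then show ?thesis
  proof (rule AE_mp, intro AE_I2 impI)
    fix \<omega> assume "\<omega> \<in> space \<P>" "\<omega> \<notin> ?A"
    then have "\<not> unbounded_growth s \<epsilon> 1 1 (clip \<omega>)" by simp
    then obtain C :: nat where
      C: "\<And>k. 1 \<le> k \<Longrightarrow> max_psum s (clip \<omega>) 1 1 k < real C * exp (\<epsilon> * real k)"
      unfolding unbounded_growth_def by (auto simp: not_le)
    show "upper_box_dim (attractor (clip \<omega>)) \<le> ereal (s + \<epsilon> / - ln b)"
    proof (rule upper_box_dim_le[OF proper_clip s \<epsilon>, of "real (Suc C)"])
      fix k :: nat assume k: "1 \<le> k"
      have "real C * exp (\<epsilon> * real k) \<le> real (Suc C) * exp (\<epsilon> * real k)"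
        by (intro mult_right_mono) auto
      then show "max_psum s (clip \<omega>) 1 1 k \<le> real (Suc C) * exp (\<epsilon> * real k)"
        using C[OF k] by linarith
    qed simp
  qed
qed

text \<open>If the Hausdorff dimension were smaller, some rational \<open>s\<close> would lie between the two dimensions
  and contradict the alternative for a small rational \<open>\<epsilon>\<close>.\<close>

lemma upper_box_dim_le_hausdorff_dim_AE:
  "AE \<omega> in \<P>. upper_box_dim (attractor (clip \<omega>)) \<le> hausdorff_dim (attractor (clip \<omega>))"
proof -
  define \<beta> where "\<beta> = - ln b"
  have \<beta>: "0 < \<beta>" using ab by (simp add: \<beta>_def)
  have "AE \<omega> in \<P>. upper_box_dim (attractor (clip \<omega>)) \<le> ereal (s + \<epsilon> / \<beta>) \<or>
      ereal s \<le> hausdorff_dim (attractor (clip \<omega>))" if "0 < s" "0 < \<epsilon>" for s \<epsilon>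
    using all_unbounded_0_1[OF that]
  proof
    assume "prob (all_unbounded s \<epsilon> 1) = 0"
    from upper_box_dim_le_AE[OF that this] show ?thesis by (rule AE_mp) (simp add: \<beta>_def)
  next
    assume "prob (all_unbounded s \<epsilon> 1) = 1"
    from hausdorff_dim_ge_AE[OF that this] show ?thesis by (rule AE_mp) simp
  qed
  then have "AE \<omega> in \<P>. \<forall>s\<in>\<rat> \<inter> {0<..}. \<forall>\<epsilon>\<in>\<rat> \<inter> {0<..}.
      upper_box_dim (attractor (clip \<omega>)) \<le> ereal (s + \<epsilon> / \<beta>) \<or> ereal s \<le> hausdorff_dim (attractor (clip \<omega>))"
    by (subst AE_ball_countable, simp add: countable_rat, intro ballI)
       (subst AE_ball_countable, auto simp: countable_rat)
  then show ?thesis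
  proof (rule AE_mp, intro AE_I2 impI)
    fix \<omega>
    let ?U = "upper_box_dim (attractor (clip \<omega>))" and ?h = "hausdorff_dim (attractor (clip \<omega>))"
    assume *: "\<forall>s\<in>\<rat> \<inter> {0<..}. \<forall>\<epsilon>\<in>\<rat> \<inter> {0<..}. ?U \<le> ereal (s + \<epsilon> / \<beta>) \<or> ereal s \<le> ?h"
    show "?U \<le> ?h"
    proof (rule ccontr)
      assume "\<not> ?U \<le> ?h"
      then obtain x where x: "?h < ereal x" "ereal x < ?U" using ereal_dense2 by (meson not_le)
      obtain y where y: "ereal x < ereal y" "ereal y < ?U" using ereal_dense2[OF x(2)] by blast
      have "0 \<le> ?h" unfolding hausdorff_dim_def by (rule INF_greatest) simp
      then have "0 < x" using x(1) by (metis ereal_less(2) le_less_trans)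
      obtain s where s: "s \<in> \<rat>" "x < s" "s < y" using Rats_dense_in_real[of x y] y(1) by auto
      have "0 < (y - s) * \<beta>" using s(3) \<beta> by simp
      then obtain \<epsilon> where e: "\<epsilon> \<in> \<rat>" "0 < \<epsilon>" "\<epsilon> < (y - s) * \<beta>" using Rats_dense_in_real by blast
      have "\<epsilon> / \<beta> < y - s" using e(3) \<beta> by (simp add: divide_less_eq)
      then have "ereal (s + \<epsilon> / \<beta>) < ?U" using y(2) by (intro le_less_trans[OF _ y(2)]) simp
      moreover have "?h < ereal s" using x(1) s(2) by (metis less_ereal.simps(1) less_trans)
      ultimately show False using *[rule_format, of s \<epsilon>] s e \<open>0 < x\<close> by auto
    qed
  qed
qed

end

section \<open>Equality of the dimensions\<close>

lemma dims_eq_of_le: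
  fixes F :: "'a::euclidean_space set"
  assumes "bounded F" "upper_box_dim F \<le> hausdorff_dim F"
  shows "hausdorff_dim F = upper_box_dim F \<and> has_box_dim F (upper_box_dim F)"
proof -
  have 1: "hausdorff_dim F \<le> Liminf (at_right 0) (box_ratio F)"
    by (rule hausdorff_dim_le_Liminf_box_ratio[OF assms(1)])
  have 2: "Liminf (at_right 0) (box_ratio F) \<le> upper_box_dim F"
    unfolding upper_box_dim_def by (rule Liminf_le_Limsup) simp
  have "(box_ratio F \<longlongrightarrow> upper_box_dim F) (at_right 0)"
    using 1 2 assms(2) by (intro Liminf_eq_Limsup) (auto simp: upper_box_dim_def)
  then show ?thesis using 1 2 assms(2) by (auto simp: has_box_dim_def)
qed

lemma finite_set_choice_pmf:
  assumes "finite (set_pmf p)" "1 \<le> V"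
  shows "finite (set_pmf (choice_pmf p M V))"
  using assms by (auto simp: choice_pmf_def set_Pi_pmf)

lemma choice_pmfD:
  assumes "c \<in> set_pmf (choice_pmf p M V)" "1 \<le> V"
  shows "fst c \<in> set_pmf p" "m \<in> {1..M (fst c)} \<Longrightarrow> snd c m \<in> {1..V}"
  using assms by (auto simp: choice_pmf_def set_Pi_pmf PiE_dflt_def set_pmf_of_set)

theorem corollary2p26:
  fixes L :: "'l set"
    and p :: "'l pmf"
    and M :: "'l \<Rightarrow> nat"
    and f :: "'l \<Rightarrow> nat \<Rightarrow> real ^ 'd \<Rightarrow> real ^ 'd"
    and V :: nat
    and \<Delta> :: "(real ^ 'd) set"
  assumes "finite L" and "set_pmf p = L"
    and "\<And>i. i \<in> L \<Longrightarrow> 1 \<le> M i"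
    and "\<And>i m. i \<in> L \<Longrightarrow> m \<in> {1..M i} \<Longrightarrow> contracting_similarity (f i m)"
    and "1 \<le> V"
    and "compact \<Delta>" and "\<Delta> \<noteq> {}"
    and "\<And>i m. i \<in> L \<Longrightarrow> m \<in> {1..M i} \<Longrightarrow> f i m ` \<Delta> \<subseteq> \<Delta>"
  shows "AE \<omega> in realisation_measure p M V.
           hausdorff_dim (V_variable_attractor M f \<Delta> \<omega>)
             = upper_box_dim (V_variable_attractor M f \<Delta> \<omega>) \<and>
           has_box_dim (V_variable_attractor M f \<Delta> \<omega>)
             (upper_box_dim (V_variable_attractor M f \<Delta> \<omega>))"
proof -
  define P where "P = (SIGMA i:L. {1..M i})"
  define \<rho> where "\<rho> = (\<lambda>i m. SOME r. 0 < r \<and> r < 1 \<and> (\<forall>x y. dist (f i m x) (f i m y) = r * dist x y))"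
  have \<rho>: "0 < \<rho> i m \<and> \<rho> i m < 1 \<and> (\<forall>x y. dist (f i m x) (f i m y) = \<rho> i m * dist x y)"
    if "(i, m) \<in> P" for i m
  proof -
    have "contracting_similarity (f i m)" using assms(4)[of i m] that by (simp add: P_def)
    then show ?thesis unfolding contracting_similarity_def \<rho>_def by (rule someI_ex)
  qed
  obtain x0 where x0: "x0 \<in> \<Delta>" using assms(7) by blast
  have "finite P" using assms(1) by (simp add: P_def)
  have "L \<noteq> {}" using assms(2) set_pmf_not_empty[of p] by simp
  then have "P \<noteq> {}" using assms(3) by (fastforce simp: P_def)
  define a where "a = Min (case_prod \<rho> ` P)"
  define b where "b = Max (case_prod \<rho> ` P)"
  have a: "0 < a" unfolding a_def using \<open>finite P\<close> \<open>P \<noteq> {}\<close> \<rho> by (subst Min_gr_iff) auto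
  have b: "b < 1" unfolding b_def using \<open>finite P\<close> \<open>P \<noteq> {}\<close> \<rho> by (subst Max_less_iff) auto
  have between: "a \<le> \<rho> i m \<and> \<rho> i m \<le> b" if "(i, m) \<in> P" for i m
    unfolding a_def b_def using \<open>finite P\<close> that by (auto intro!: Min_le Max_ge image_eqI[of _ _ "(i, m)"])
  obtain i0 m0 where "(i0, m0) \<in> P" using \<open>P \<noteq> {}\<close> by auto
  from between[OF this] have "a \<le> b" by linarith
  obtain R0 where R0: "\<Delta> \<subseteq> cball x0 R0"
    using compact_imp_bounded[OF assms(6)] bounded_any_center[of \<Delta> x0]
    by (auto simp: subset_iff)
  \<comment> \<open>a radius for which the ball around \<open>x0\<close> contains \<open>\<Delta>\<close> and is invariant under all maps\<close>
  define R where "R = Max (insert 1 (insert R0 ((\<lambda>(i, m). dist (f i m x0) x0 / (1 - \<rho> i m)) ` P)))"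
  have R: "1 \<le> R" "R0 \<le> R"
    unfolding R_def using \<open>finite P\<close> by (rule_tac [!] Max_ge) auto
  have ball: "dist (f i m x0) x0 \<le> (1 - \<rho> i m) * R" if "(i, m) \<in> P" for i m
  proof -
    have "dist (f i m x0) x0 / (1 - \<rho> i m) \<le> R"
      unfolding R_def using \<open>finite P\<close> that by (intro Max_ge) (auto intro!: image_eqI[of _ _ "(i, m)"])
    then show ?thesis using \<rho>[OF that] by (simp add: divide_le_eq mult.commute)
  qed
  let ?S = "set_pmf (choice_pmf p M V)"
  have S: "(fst c, m) \<in> P" if "c \<in> ?S" "1 \<le> m" "m \<le> M (fst c)" for c m
    using choice_pmfD(1)[OF that(1) assms(5)] that assms(2) by (simp add: P_def)
  interpret random_family ?S M f \<rho> V \<Delta> x0 R a b p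
  proof
    show "finite ?S" using finite_set_choice_pmf assms(1,2,5) by blast
    show "?S \<noteq> {}" by (rule set_pmf_not_empty)
    show "1 \<le> M (fst c)" if "c \<in> ?S" for c
      using choice_pmfD(1)[OF that assms(5)] assms(2,3) by simp
    show "snd c m \<in> {1..V}" if "c \<in> ?S" "1 \<le> m" "m \<le> M (fst c)" for c m
      using choice_pmfD(2)[OF that(1) assms(5), of m] that by simp
    show "f (fst c) m ` \<Delta> \<subseteq> \<Delta>" if "c \<in> ?S" "1 \<le> m" "m \<le> M (fst c)" for c m
      using assms(8) S[OF that] by (auto simp: P_def)
    show "\<Delta> \<subseteq> cball x0 R" using R0 R(2) by auto
  qed (use S \<rho> between a b \<open>a \<le> b\<close> R ball assms(5,6) x0 in auto)
  have "AE \<omega> in realisation_measure p M V. attractor \<omega> = attractor (clip \<omega>)"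
    using AE_clip by (rule AE_mp) (intro AE_I2 impI attractor_clip)
  then show ?thesis
    using upper_box_dim_le_hausdorff_dim_AE
  proof eventually_elim
    case (elim \<omega>)
    have "bounded (attractor (clip \<omega>))"
      using attractor_compact[OF proper_clip] by (rule compact_imp_bounded)
    then show ?case unfolding elim(1) using elim(2) by (rule dims_eq_of_le)
  qed
qed

end
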